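(* Let $\Omega\subset\mathbb{R}^n$ be a bounded domain, let $x_b\in\partial\Omega$ satisfy the interior cone condition, with $\Omega_b$ the interior of a corresponding cone of finite height in $\Omega$ with apex $x_b$, and let $A:\Omega\times\mathbb{R}\times\mathbb{R}^n\to\mathbb{R}^n$, $B:\Omega\times\mathbb{R}\times\mathbb{R}^n\to\mathbb{R}$ and $u,v:\bar\Omega\to\mathbb{R}$ be such that: - $u,v\in C^1(\bar\Omega)$; - $u$ and $v$ satisfy, in the $C^1$ weak sense, respectively, $$\operatorname{div}(A(\cdot,u,Du))+B(\cdot,u,Du)\ge0\ \text{ on }\Omega,\qquad \operatorname{div}(A(\cdot,v,Dv))+B(\cdot,v,Dv)\le0\ \text{ on }\Omega;$$ - $A=A(x,z,\eta)$ is continuous, and continuously differentiable with respect to $z$ and $\eta$; - $A_z$ is uniformly bounded and $A_\eta$ is uniformly continuous on $\Omega_b\times[u(x_b)-M_z,u(x_b)+M_z]\times[-M_\eta,M_\eta]^n$ for some constants $M_z,M_\eta>0$; - $B$ satisfies $$B(x,z_1,\eta_1)-B(x,z_2,\eta_2)\ge-b_z(z_1-z_2)-b_\eta\sum_{l=1}^n|\eta_{1l}-\eta_{2l}|$$ for all $(x,z_1,\eta_1),(x,z_2,\eta_2)\in\Omega_b\times[u(x_b)-M_z,u(x_b)+M_z]\times[-M_\eta,M_\eta]^n$ with $z_1\ge z_2$, for some constants $b_z,b_\eta\ge0$; - $u$ is an elliptic solution of $\operatorname{div}(A(\cdot,u,Du))+B(\cdot,u,Du)\ge0$ with respect to $A$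 in $\Omega_b$; - $u<v$ in $\Omega_b$; and $u(x_b)=v(x_b)$. Then the zero of $v-u$ at $x_b$ is of finite order.
   Context: A bounded domain is an open connected bounded set. $Du$ is the gradient of $u$, and $\eta_{kl}$ denotes the $l$-th component of $\eta_k\in\mathbb{R}^n$. Interior cone condition: $x_b\in\partial\Omega$ satisfies an interior cone condition if there exists a cone of finite height in $\Omega$ with apex $x_b$; the interior of such a cone is denoted $\Omega_b$. $C^1$ weak solutions: $u$ is a $C^1$ weak solution of $\operatorname{div}(A(\cdot,u,Du))+B(\cdot,u,Du)\ge0$ on $\Omega$ if $u\in C^1(\bar\Omega)$, $A(\cdot,u,Du),B(\cdot,u,Du)\in L^1_{\mathrm{loc}}(\Omega)$ and $$\int_\Omega A(x,u(x),Du(x))\cdot D\psi(x)\,dx\le\int_\Omega B(x,u(x),Du(x))\psi(x)\,dx$$ for every test function $\psi\in C^1(\bar\Omega)$ with $\psi\ge0$ on $\Omega$ and compact support in $\Omega$. Weak solutions $v$ of the inequality with $\le0$ are defined analogously, with the integral inequality reversed. Elliptic solution: $u$ is an elliptic solution in $\Omega_b$ if $a_{ij}(x)=(A_i)_{\eta_j}(x,u(x),Du(x))$ satisfies $|y|^2\le\sum_{i,j=1}^n a_{ij}(x)y_iy_j$ for all $x\in\Omega_b$, $y\in\mathbb{R}^n$. Order of a zero: a function $w$ on $\bar\Omega$ with $w(x_b)=0$ has a zero of infinite order at $x_b$ if for every $m\in\mathbb{N}$, $w(x)=O(|x-x_b|^m)$ as $x\to x_b$, $x\in\bar\Omega$;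 otherwise the zero is of finite order.
   Formalization: The formal statement adds that every component of Du(x_b) satisfies |D_l u(x_b)| < M_η, so the box [-M_η,M_η]^n contains Du(x_b) in its interior; without this the claim is false (u=10x, v=10x+exp(-1/x), M_η=1). *)

theory Defs
  imports "HOL-Analysis.Analysis" "HOL-Library.Landau_Symbols"
begin

text \<open>
  Functions on \<open>\<Omega>\<close> or on its closure are total functions here; their values elsewhere are
  never used. Derivatives are only taken at points of the open set \<open>\<Omega>\<close>.
\<close>

definition bounded_domain :: "(real ^ 'n) set \<Rightarrow> bool" where
  "bounded_domain \<Omega> \<longleftrightarrow> open \<Omega> \<and> connected \<Omega> \<and> bounded \<Omega>"

definition grad :: "(real ^ 'n \<Rightarrow> real) \<Rightarrow> real ^ 'n \<Rightarrow> real ^ 'n" where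
  "grad f x = (\<chi> l. frechet_derivative f (at x) (axis l 1))"

text \<open>The class \<open>C\<^sup>1\<close> of the closure: \<open>f\<close> is continuous up to the boundary and its gradient on
  \<open>\<Omega>\<close> extends continuously to the closure; \<open>grad_ext \<Omega> f\<close> is this extension.
  It gives the meaning of \<open>Du(x\<^sub>b)\<close>, which has to lie inside the box \<open>[-M\<^sub>\<eta>, M\<^sub>\<eta>]\<^sup>n\<close>: otherwise
  the structure conditions on that box say nothing about \<open>A\<close> and \<open>B\<close> along \<open>u\<close> near \<open>x\<^sub>b\<close>.\<close>

definition C1_closure :: "(real ^ 'n) set \<Rightarrow> (real ^ 'n \<Rightarrow> real) \<Rightarrow> bool" where
  "C1_closure \<Omega> f \<longleftrightarrow>
     continuous_on (closure \<Omega>) f \<and> (\<forall>x\<in>\<Omega>. f differentiable (at x)) \<and>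
     (\<exists>G. continuous_on (closure \<Omega>) G \<and> (\<forall>x\<in>\<Omega>. G x = grad f x))"

definition grad_ext :: "(real ^ 'n) set \<Rightarrow> (real ^ 'n \<Rightarrow> real) \<Rightarrow> real ^ 'n \<Rightarrow> real ^ 'n" where
  "grad_ext \<Omega> f x = Lim (at x within \<Omega>) (grad f)"

text \<open>The right circular cone with apex \<open>a\<close>, unit axis \<open>e\<close>, half-angle \<open>\<theta>\<close> and height \<open>h\<close>.\<close>

definition finite_cone :: "real ^ 'n \<Rightarrow> real ^ 'n \<Rightarrow> real \<Rightarrow> real \<Rightarrow> (real ^ 'n) set" where
  "finite_cone a e \<theta> h =
     {x. cos \<theta> * norm (x - a) \<le> (x - a) \<bullet> e \<and> (x - a) \<bullet> e \<le> h}"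

text \<open>Containment in \<open>\<Omega>\<close> is required of the interior of the cone, since the apex, being a boundary
  point, never lies in the open set \<open>\<Omega>\<close>.\<close>

definition interior_cone_at :: "(real ^ 'n) set \<Rightarrow> real ^ 'n \<Rightarrow> (real ^ 'n) set \<Rightarrow> bool" where
  "interior_cone_at \<Omega> a \<Omega>b \<longleftrightarrow>
     (\<exists>e \<theta> h. norm e = 1 \<and> 0 < \<theta> \<and> \<theta> < pi / 2 \<and> 0 < h \<and>
        \<Omega>b = interior (finite_cone a e \<theta> h) \<and> \<Omega>b \<subseteq> \<Omega>)"

definition deriv_z ::
    "(real ^ 'n \<Rightarrow> real \<Rightarrow> real ^ 'n \<Rightarrow> real ^ 'n) \<Rightarrow> real ^ 'n \<Rightarrow> real \<Rightarrow> real ^ 'n \<Rightarrow> real ^ 'n" where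
  "deriv_z A x z \<eta> = vector_derivative (\<lambda>t. A x t \<eta>) (at z)"

text \<open>\<open>deriv_eta A x z \<eta> $ i $ j\<close> is the partial derivative of \<open>A\<^sub>i\<close> with respect to \<open>\<eta>\<^sub>j\<close>.\<close>

definition deriv_eta ::
    "(real ^ 'n \<Rightarrow> real \<Rightarrow> real ^ 'n \<Rightarrow> real ^ 'n) \<Rightarrow> real ^ 'n \<Rightarrow> real \<Rightarrow> real ^ 'n \<Rightarrow> real ^ 'n ^ 'n" where
  "deriv_eta A x z \<eta> = jacobian (\<lambda>\<xi>. A x z \<xi>) (at \<eta>)"

definition C1_in_z_eta ::
    "(real ^ 'n) set \<Rightarrow> (real ^ 'n \<Rightarrow> real \<Rightarrow> real ^ 'n \<Rightarrow> real ^ 'n) \<Rightarrow> bool" where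
  "C1_in_z_eta \<Omega> A \<longleftrightarrow>
     (\<forall>x\<in>\<Omega>.
        (\<forall>z \<eta>. (\<lambda>t. A x t \<eta>) differentiable (at z) \<and> (\<lambda>\<xi>. A x z \<xi>) differentiable (at \<eta>)) \<and>
        continuous_on UNIV (\<lambda>(z, \<eta>). deriv_z A x z \<eta>) \<and>
        continuous_on UNIV (\<lambda>(z, \<eta>). deriv_eta A x z \<eta>))"

definition L1_loc :: "(real ^ 'n) set \<Rightarrow> (real ^ 'n \<Rightarrow> 'b::euclidean_space) \<Rightarrow> bool" where
  "L1_loc \<Omega> f \<longleftrightarrow> (\<forall>K. compact K \<and> K \<subseteq> \<Omega> \<longrightarrow> f absolutely_integrable_on K)"

definition test_function :: "(real ^ 'n) set \<Rightarrow> (real ^ 'n \<Rightarrow> real) \<Rightarrow> bool" where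
  "test_function \<Omega> \<psi> \<longleftrightarrow>
     C1_closure \<Omega> \<psi> \<and> (\<forall>x\<in>\<Omega>. 0 \<le> \<psi> x) \<and>
     compact (closure {x\<in>\<Omega>. \<psi> x \<noteq> 0}) \<and> closure {x\<in>\<Omega>. \<psi> x \<noteq> 0} \<subseteq> \<Omega>"

text \<open>\<open>C\<^sup>1\<close> weak solutions of \<open>div (A(\<cdot>,u,Du)) + B(\<cdot>,u,Du) \<ge> 0\<close> and of the reversed inequality.\<close>

definition weak_solution_ge ::
    "(real ^ 'n) set \<Rightarrow> (real ^ 'n \<Rightarrow> real \<Rightarrow> real ^ 'n \<Rightarrow> real ^ 'n) \<Rightarrow>
     (real ^ 'n \<Rightarrow> real \<Rightarrow> real ^ 'n \<Rightarrow> real) \<Rightarrow> (real ^ 'n \<Rightarrow> real) \<Rightarrow> bool" where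
  "weak_solution_ge \<Omega> A B u \<longleftrightarrow>
     C1_closure \<Omega> u \<and>
     L1_loc \<Omega> (\<lambda>x. A x (u x) (grad u x)) \<and> L1_loc \<Omega> (\<lambda>x. B x (u x) (grad u x)) \<and>
     (\<forall>\<psi>. test_function \<Omega> \<psi> \<longrightarrow>
        (LINT x:\<Omega>|lebesgue. A x (u x) (grad u x) \<bullet> grad \<psi> x)
          \<le> (LINT x:\<Omega>|lebesgue. B x (u x) (grad u x) * \<psi> x))"

definition weak_solution_le ::
    "(real ^ 'n) set \<Rightarrow> (real ^ 'n \<Rightarrow> real \<Rightarrow> real ^ 'n \<Rightarrow> real ^ 'n) \<Rightarrow>
     (real ^ 'n \<Rightarrow> real \<Rightarrow> real ^ 'n \<Rightarrow> real) \<Rightarrow> (real ^ 'n \<Rightarrow> real) \<Rightarrow> bool" where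
  "weak_solution_le \<Omega> A B v \<longleftrightarrow>
     C1_closure \<Omega> v \<and>
     L1_loc \<Omega> (\<lambda>x. A x (v x) (grad v x)) \<and> L1_loc \<Omega> (\<lambda>x. B x (v x) (grad v x)) \<and>
     (\<forall>\<psi>. test_function \<Omega> \<psi> \<longrightarrow>
        (LINT x:\<Omega>|lebesgue. A x (v x) (grad v x) \<bullet> grad \<psi> x)
          \<ge> (LINT x:\<Omega>|lebesgue. B x (v x) (grad v x) * \<psi> x))"

definition elliptic_in ::
    "(real ^ 'n) set \<Rightarrow> (real ^ 'n \<Rightarrow> real \<Rightarrow> real ^ 'n \<Rightarrow> real ^ 'n) \<Rightarrow> (real ^ 'n \<Rightarrow> real) \<Rightarrow> bool" where
  "elliptic_in \<Omega>b A u \<longleftrightarrow>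
     (\<forall>x\<in>\<Omega>b. \<forall>y. (norm y)\<^sup>2 \<le>
        (\<Sum>i\<in>UNIV. \<Sum>j\<in>UNIV. deriv_eta A x (u x) (grad u x) $ i $ j * y $ i * y $ j))"

definition infinite_order_zero :: "(real ^ 'n) set \<Rightarrow> (real ^ 'n \<Rightarrow> real) \<Rightarrow> real ^ 'n \<Rightarrow> bool" where
  "infinite_order_zero S w a \<longleftrightarrow>
     w a = 0 \<and> (\<forall>m::nat. w \<in> O[at a within S](\<lambda>x. norm (x - a) ^ m))"

definition finite_order_zero :: "(real ^ 'n) set \<Rightarrow> (real ^ 'n \<Rightarrow> real) \<Rightarrow> real ^ 'n \<Rightarrow> bool" where
  "finite_order_zero S w a \<longleftrightarrow> w a = 0 \<and> \<not> infinite_order_zero S w a"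

end

theory Submission
  imports Defs
begin

text \<open>
  Let \<open>w = v - u\<close>, which is positive in the cone and vanishes at its apex. The idea is to control
  the logarithm of \<open>w\<close>. Near the apex the difference of the two weak inequalities says that \<open>w\<close> is
  a weak supersolution of a linear elliptic inequality with bounded coefficients. Testing it with
  \<open>\<eta>\<^sup>2 / w\<close>, where \<open>\<eta>\<close> is a cutoff function, bounds the energy of \<open>log w\<close>: for boxes \<open>Q\<^sub>s\<close> of
  size proportional to \<open>s\<close> that are centred on the axis at distance \<open>s\<close> from the apex, the integral of
  \<open>\<eta>\<^sup>2 |D log w|\<^sup>2\<close>, after scaling to a fixed box, is at most \<open>C / s\<^sup>2\<close> with \<open>C\<close> independent of \<open>s\<close>
  (lemmas \<open>log_energy_estimate\<close> and \<open>rescaled_log_energy\<close>). Hence the weighted mean of \<open>log w\<close> over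
  \<open>Q\<^sub>s\<close> has a derivative of order \<open>1 / s\<close> with respect to \<open>s\<close>, and so the mean is bounded below by
  \<open>c + M log s\<close> (lemma \<open>log_mean_lower_bound\<close>). A zero of infinite order would make \<open>w\<close> smaller than
  every power of \<open>s\<close>, and the mean would lie below \<open>c\<^sub>m + m I log s\<close> for each \<open>m\<close>, where \<open>I\<close> is the
  total weight; this is impossible for large \<open>m\<close> (lemma \<open>log_mean_bound_excludes_powers\<close>). No
  Harnack inequality is involved.

  The linearization uses the infinite order as well. Ellipticity is assumed along \<open>u\<close> only, and
  it passes to the difference of the fluxes because \<open>A\<^sub>\<eta>\<close> is uniformly continuous and \<open>Dv - Du\<close>
  tends to \<open>0\<close> at the apex. The latter holds since \<open>w\<close> is of second order there
  (lemma \<open>gradient_limit_zero_of_quadratic_bound\<close>); the same fact brings \<open>Dv\<close> into the box on which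
  the structure conditions hold.
\<close>

section \<open>The test function\<close>

lemma has_derivative_grad:
  fixes f :: "real ^ 'n \<Rightarrow> real"
  assumes "f differentiable (at x)"
  shows "(f has_derivative (\<lambda>h. grad f x \<bullet> h)) (at x)"
proof -
  let ?f' = "frechet_derivative f (at x)"
  have D: "(f has_derivative ?f') (at x)"
    using assms frechet_derivative_works by blast
  then interpret bounded_linear ?f' by (rule has_derivative_bounded_linear)
  have "?f' h = grad f x \<bullet> h" for h
  proof -
    have "?f' h = ?f' (\<Sum>l\<in>UNIV. h $ l *\<^sub>R axis l 1)"
      using basis_expansion[of h] by (simp add: scalar_mult_eq_scaleR)
    also have "\<dots> = (\<Sum>l\<in>UNIV. h $ l * ?f' (axis l 1))"
      by (simp add: sum scaleR)
    finally show ?thesis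
      by (simp add: grad_def inner_vec_def mult.commute)
  qed
  then have "?f' = (\<lambda>h. grad f x \<bullet> h)" by auto
  with D show ?thesis by simp
qed

lemma grad_eqI:
  fixes f :: "real ^ 'n \<Rightarrow> real"
  assumes "(f has_derivative (\<lambda>h. p \<bullet> h)) (at x)"
  shows "grad f x = p"
  by (simp add: grad_def vec_eq_iff inner_axis flip: frechet_derivative_at[OF assms])

text \<open>
  The exponent makes the bump once continuously differentiable, and it makes it the square
  \<open>\<eta>\<^sup>2\<close> of the Lipschitz function \<open>\<eta> = max 0 (r\<^sup>2 - |x - c|\<^sup>2)\<close>, so that its gradient is bounded
  by a multiple of \<open>\<eta>\<close>. This is what allows the energy of \<open>log w\<close>
  to absorb the terms that contain this gradient.
\<close>

definition bump :: "'a::real_inner \<Rightarrow> real \<Rightarrow> 'a \<Rightarrow> real" where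
  "bump c r x = (max 0 (r\<^sup>2 - (norm (x - c))\<^sup>2))\<^sup>2"

definition bump_grad :: "'a::real_inner \<Rightarrow> real \<Rightarrow> 'a \<Rightarrow> 'a" where
  "bump_grad c r x = (- 4 * max 0 (r\<^sup>2 - (norm (x - c))\<^sup>2)) *\<^sub>R (x - c)"

lemma bump_nonneg: "0 \<le> bump c r x"
  by (simp add: bump_def)

lemma bump_eq_0_outside: "x \<notin> cball c r \<Longrightarrow> 0 < r \<Longrightarrow> bump c r x = 0"
  by (auto simp: bump_def dist_norm norm_minus_commute max_def dest!: power_strict_mono[of r _ 2])

lemma bump_grad_eq_0_outside: "x \<notin> cball c r \<Longrightarrow> 0 < r \<Longrightarrow> bump_grad c r x = 0"
  by (auto simp: bump_grad_def dist_norm norm_minus_commute max_def dest!: power_strict_mono[of r _ 2])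

lemma continuous_on_bump [continuous_intros]: "continuous_on S (bump c r)"
  unfolding bump_def by (intro continuous_intros)

lemma continuous_on_bump_grad [continuous_intros]: "continuous_on S (bump_grad c r)"
  unfolding bump_grad_def by (intro continuous_intros)

lemma bump_scale:
  assumes "0 < s"
  shows "bump (a + s *\<^sub>R e) (s * r) (a + s *\<^sub>R y) = s ^ 4 * bump e r y"
proof -
  have "(s * r)\<^sup>2 - (norm (a + s *\<^sub>R y - (a + s *\<^sub>R e)))\<^sup>2 = s\<^sup>2 * (r\<^sup>2 - (norm (y - e))\<^sup>2)"
  proof -
    have "a + s *\<^sub>R y - (a + s *\<^sub>R e) = s *\<^sub>R (y - e)" by (simp add: scaleR_diff_right)
    then show ?thesis by (simp add: power_mult_distrib right_diff_distrib)
  qed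
  moreover have "max 0 (s\<^sup>2 * t) = s\<^sup>2 * max 0 t" for t :: real
    by (auto simp: max_def zero_le_mult_iff mult_le_0_iff)
  ultimately show ?thesis
    by (simp add: bump_def power_mult_distrib)
qed

text \<open>
  At the kink \<open>t = 0\<close> the difference quotient is at most \<open>|h|\<close>.
\<close>

lemma DERIV_max_0_power2:
  "((\<lambda>t::real. (max 0 t)\<^sup>2) has_real_derivative 2 * max 0 t) (at t)"
proof -
  consider "t < 0" | "t = 0" | "t > 0" by linarith
  then show ?thesis
  proof cases
    case 1
    have "((\<lambda>t::real. 0) has_real_derivative 0) (at t)" by simp
    then have "((\<lambda>t::real. (max 0 t)\<^sup>2) has_real_derivative 0) (at t)"
      by (rule has_field_derivative_transform_within_open[of _ _ _ "{..<0}"]) (use 1 in auto)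
    then show ?thesis using 1 by simp
  next
    case 2
    have "((\<lambda>h::real. (max 0 h)\<^sup>2 / h) \<longlongrightarrow> 0) (at 0)"
    proof (rule Lim_null_comparison)
      show "\<forall>\<^sub>F h in at (0::real). norm ((max 0 h)\<^sup>2 / h) \<le> \<bar>h\<bar>"
        by (rule always_eventually) (auto simp: max_def power2_eq_square)
      show "((\<lambda>h::real. \<bar>h\<bar>) \<longlongrightarrow> 0) (at 0)"
        by (rule tendsto_eq_intros refl | simp)+
    qed
    then show ?thesis using 2 by (simp add: DERIV_def)
  next
    case 3
    have "((\<lambda>t::real. t\<^sup>2) has_real_derivative 2 * t) (at t)"
      by (auto intro!: derivative_eq_intros)
    then have "((\<lambda>t::real. (max 0 t)\<^sup>2) has_real_derivative 2 * t) (at t)"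
      by (rule has_field_derivative_transform_within_open[of _ _ _ "{0<..}"]) (use 3 in auto)
    then show ?thesis using 3 by simp
  qed
qed

lemma has_derivative_bump:
  "(bump c r has_derivative (\<lambda>h. bump_grad c r x \<bullet> h)) (at x)"
proof -
  have 1: "((\<lambda>x. r\<^sup>2 - (norm (x - c))\<^sup>2) has_derivative (\<lambda>h. - 2 * ((x - c) \<bullet> h))) (at x)"
    unfolding power2_norm_eq_inner
    by (auto intro!: derivative_eq_intros simp: inner_commute algebra_simps)
  have "((\<lambda>x. (max 0 (r\<^sup>2 - (norm (x - c))\<^sup>2))\<^sup>2) has_derivative
     (\<lambda>h. 2 * max 0 (r\<^sup>2 - (norm (x - c))\<^sup>2) * (- 2 * ((x - c) \<bullet> h)))) (at x)"
    using has_derivative_compose[OF 1 DERIV_max_0_power2[unfolded has_field_derivative_def]]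
    by simp
  then show ?thesis
    unfolding bump_def[abs_def]
    by (rule has_derivative_eq_rhs) (auto simp: bump_grad_def inner_diff_left algebra_simps)
qed

text \<open>
  The quotient rule for \<open>bump c r / w\<close>, with \<open>p\<close> standing for the gradient of \<open>w\<close>. Outside the
  ball \<open>cball c r\<close> both bump terms vanish, so the value is \<open>0\<close> there whatever \<open>w\<close> is.
\<close>

definition quotient_grad ::
    "'a::real_inner \<Rightarrow> real \<Rightarrow> ('a \<Rightarrow> real) \<Rightarrow> ('a \<Rightarrow> 'a) \<Rightarrow> 'a \<Rightarrow> 'a" where
  "quotient_grad c r w p x =
     (1 / w x) *\<^sub>R bump_grad c r x - (bump c r x / (w x)\<^sup>2) *\<^sub>R p x"

text \<open>
  Outside \<open>U\<close> nothing is known about \<open>w\<close>, but there the numerator vanishes in a whole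
  neighbourhood; this gives differentiability at every point of the space.
\<close>

lemma has_derivative_bump_quotient:
  fixes w :: "'a::real_inner \<Rightarrow> real"
  assumes U: "open U" "cball c r \<subseteq> U" "0 < r"
    and w: "\<And>x. x \<in> U \<Longrightarrow> 0 < w x"
    and dw: "\<And>x. x \<in> U \<Longrightarrow> (w has_derivative (\<lambda>h. p x \<bullet> h)) (at x)"
  shows "((\<lambda>x. bump c r x / w x) has_derivative (\<lambda>h. quotient_grad c r w p x \<bullet> h)) (at x)"
proof (cases "x \<in> U")
  case True
  then have nz: "w x \<noteq> 0" using w by force
  have "((\<lambda>x. bump c r x / w x) has_derivative
     (\<lambda>h. (bump_grad c r x \<bullet> h * w x - bump c r x * (p x \<bullet> h)) / (w x * w x))) (at x)"
    by (rule has_derivative_divide'[OF has_derivative_bump dw[OF True] nz])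
  then show ?thesis
    using nz by (auto elim!: back_subst[of "\<lambda>f. (_ has_derivative f) (at x)"]
        simp: quotient_grad_def inner_diff_left field_simps power2_eq_square)
next
  case False
  then have x: "x \<in> - cball c r" using U by auto
  have "((\<lambda>x. 0::real) has_derivative (\<lambda>h. 0)) (at x)" by simp
  then have "((\<lambda>x. bump c r x / w x) has_derivative (\<lambda>h. 0)) (at x)"
    by (rule has_derivative_transform_within_open[of _ _ _ _ "- cball c r"])
       (use x U in \<open>auto simp: bump_eq_0_outside simp del: mem_cball\<close>)
  then show ?thesis
    using x U by (simp add: quotient_grad_def bump_eq_0_outside bump_grad_eq_0_outside)
qed

text \<open>
  The open sets \<open>U\<close> and \<open>- cball c r\<close> cover the space, and the function is continuous on each.
\<close>

lemma continuous_on_quotient_grad: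
  fixes w :: "'a::real_inner \<Rightarrow> real"
  assumes U: "open U" "cball c r \<subseteq> U" "0 < r"
    and w: "\<And>x. x \<in> U \<Longrightarrow> 0 < w x"
    and cont: "continuous_on U w" "continuous_on U p"
  shows "continuous_on UNIV (quotient_grad c r w p)"
proof -
  have "continuous_on U (quotient_grad c r w p)"
    unfolding quotient_grad_def[abs_def] using w by (intro continuous_intros cont) force+
  moreover have "continuous_on (- cball c r) (quotient_grad c r w p)"
    by (rule continuous_on_eq[where f = "\<lambda>x. 0"])
       (use U in \<open>auto simp: quotient_grad_def bump_eq_0_outside bump_grad_eq_0_outside simp del: mem_cball\<close>)
  ultimately have "continuous_on (U \<union> - cball c r) (quotient_grad c r w p)"
    using U by (intro continuous_on_open_Un) auto
  moreover have "U \<union> - cball c r = UNIV" using U by auto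
  ultimately show ?thesis by simp
qed

text \<open>
  Division by \<open>w\<close> is the choice of test function that turns an energy estimate for \<open>w\<close> into one
  for \<open>log w\<close>: its gradient contains \<open>- \<eta>\<^sup>2 Dw / w\<^sup>2\<close>.
\<close>

lemma test_function_bump_quotient:
  fixes w :: "real ^ 'n \<Rightarrow> real"
  assumes U: "open U" "cball c r \<subseteq> U" "0 < r" "U \<subseteq> \<Omega>"
    and w: "\<And>x. x \<in> U \<Longrightarrow> 0 < w x"
    and dw: "\<And>x. x \<in> U \<Longrightarrow> (w has_derivative (\<lambda>h. p x \<bullet> h)) (at x)"
    and cont: "continuous_on U p"
  shows "test_function \<Omega> (\<lambda>x. bump c r x / w x)"
    and "grad (\<lambda>x. bump c r x / w x) = quotient_grad c r w p"
    and "continuous_on S (\<lambda>x. bump c r x / w x)"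
proof -
  let ?\<psi> = "\<lambda>x. bump c r x / w x"
  have D: "(?\<psi> has_derivative (\<lambda>h. quotient_grad c r w p x \<bullet> h)) (at x)" for x
    by (rule has_derivative_bump_quotient[OF U(1-3) w dw])
  have cw: "continuous_on U w"
    using dw by (meson U(1) continuous_on_eq_continuous_at has_derivative_continuous)
  show grad: "grad ?\<psi> = quotient_grad c r w p"
    using grad_eqI[OF D] by auto
  show cpsi: "continuous_on S ?\<psi>" for S
    using D by (meson continuous_at_imp_continuous_on has_derivative_continuous)
  have cg: "continuous_on (closure \<Omega>) (grad ?\<psi>)"
    using continuous_on_quotient_grad[OF U(1-3) w cw cont] grad continuous_on_subset
    by (metis subset_UNIV)
  have "{x\<in>\<Omega>. ?\<psi> x \<noteq> 0} \<subseteq> cball c r"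
    using bump_eq_0_outside[of _ c r] U(3) by (auto simp del: mem_cball)
  then have supp: "closure {x\<in>\<Omega>. ?\<psi> x \<noteq> 0} \<subseteq> cball c r"
    by (simp add: closure_minimal)
  then have "compact (closure {x\<in>\<Omega>. ?\<psi> x \<noteq> 0})"
    by (meson bounded_cball bounded_subset closed_closure compact_eq_bounded_closed)
  moreover have "?\<psi> x \<ge> 0" for x
  proof (cases "x \<in> U")
    case True
    then show ?thesis using w[OF True] by (simp add: bump_nonneg)
  next
    case False
    then have "x \<notin> cball c r" using U by blast
    then show ?thesis using bump_eq_0_outside[of x c r] U by simp
  qed
  moreover have "C1_closure \<Omega> ?\<psi>"
    unfolding C1_closure_def using cpsi cg D differentiableI by blast
  ultimately show "test_function \<Omega> ?\<psi>"
    unfolding test_function_def using supp U by blast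
qed

text \<open>
  With \<open>q = |p| / w\<close>, coercivity makes the term \<open>- \<eta>\<^sup>2 P \<bullet> p / w\<^sup>2\<close> at most \<open>- \<eta>\<^sup>2 q\<^sup>2 / 2\<close> up to
  \<open>K \<eta>\<^sup>2 q\<close>. All other terms are at most linear in \<open>y = \<eta> q\<close>, because \<open>D\<close> carries a factor \<open>\<eta>\<close>,
  and Young's inequality absorbs them at the cost of \<open>y\<^sup>2 / 4\<close>. The resulting constant does not
  depend on \<open>w\<close>.
\<close>

lemma log_energy_pointwise:
  fixes P p D :: "'a::real_inner"
  assumes pos: "0 < w" "0 \<le> \<eta>" "0 \<le> K" "0 \<le> b" "0 \<le> \<delta>"
    and coercive: "P \<bullet> p \<ge> (norm p)\<^sup>2 / 2 - K * w * norm p"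
    and growth: "norm P \<le> K * (norm p + w)"
    and D: "norm D \<le> \<eta> * \<delta>"
    and S: "S \<le> L * norm p" "0 \<le> L"
  shows "P \<bullet> ((1 / w) *\<^sub>R D - (\<eta>\<^sup>2 / w\<^sup>2) *\<^sub>R p) + (b * w + S) * (\<eta>\<^sup>2 / w)
    \<le> - (\<eta>\<^sup>2 * (norm p / w)\<^sup>2) / 4 + (2 * K\<^sup>2 + K) * \<delta>\<^sup>2 + (2 * (K + L)\<^sup>2 + K + b) * \<eta>\<^sup>2"
proof -
  define q where "q = norm p / w"
  define y where "y = \<eta> * q"
  have q: "q \<ge> 0" "norm p = q * w" using pos by (auto simp: q_def)
  have "P \<bullet> D \<le> norm P * norm D" by (rule norm_cauchy_schwarz)
  also have "\<dots> \<le> K * (norm p + w) * (\<eta> * \<delta>)"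
    using growth D by (intro mult_mono) (use pos in auto)
  finally have 1: "P \<bullet> D / w \<le> K * (q + 1) * (\<eta> * \<delta>)"
    using pos(1) q by (simp add: field_simps)
  have "q\<^sup>2 * w\<^sup>2 / 2 - K * q * w\<^sup>2 \<le> P \<bullet> p"
    using coercive q by (simp add: power2_eq_square algebra_simps)
  then have "q\<^sup>2 / 2 - K * q \<le> (P \<bullet> p) / w\<^sup>2"
    using pos(1) by (simp add: field_simps)
  then have 2: "\<eta>\<^sup>2 * (q\<^sup>2 / 2 - K * q) \<le> \<eta>\<^sup>2 * ((P \<bullet> p) / w\<^sup>2)"
    by (intro mult_left_mono) auto
  have "(b * w + S) / w \<le> b + L * q"
    using S(1) q pos(1) by (simp add: field_simps)
  then have "\<eta>\<^sup>2 * ((b * w + S) / w) \<le> \<eta>\<^sup>2 * (b + L * q)"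
    by (intro mult_left_mono) auto
  with 1 2 have "P \<bullet> ((1 / w) *\<^sub>R D - (\<eta>\<^sup>2 / w\<^sup>2) *\<^sub>R p) + (b * w + S) * (\<eta>\<^sup>2 / w)
     \<le> K * (q + 1) * (\<eta> * \<delta>) - \<eta>\<^sup>2 * (q\<^sup>2 / 2 - K * q) + \<eta>\<^sup>2 * (b + L * q)"
    by (simp add: inner_diff_right mult.commute)
  also have "\<dots> = K * y * \<delta> + K * (\<eta> * \<delta>) - y\<^sup>2 / 2 + (K + L) * y * \<eta> + b * \<eta>\<^sup>2"
    by (simp add: y_def power2_eq_square algebra_simps)
  also have "\<dots> \<le> - y\<^sup>2 / 4 + (2 * K\<^sup>2 + K) * \<delta>\<^sup>2 + (2 * (K + L)\<^sup>2 + K + b) * \<eta>\<^sup>2"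
  proof -
    have "K * y * \<delta> \<le> y\<^sup>2 / 8 + 2 * K\<^sup>2 * \<delta>\<^sup>2"
      using zero_le_power2[of "y - 4 * K * \<delta>"] by (simp add: power2_eq_square algebra_simps)
    moreover have "(K + L) * y * \<eta> \<le> y\<^sup>2 / 8 + 2 * (K + L)\<^sup>2 * \<eta>\<^sup>2"
      using zero_le_power2[of "y - 4 * (K + L) * \<eta>"] by (simp add: power2_eq_square algebra_simps)
    moreover have "\<eta> * \<delta> \<le> \<eta>\<^sup>2 + \<delta>\<^sup>2"
      using zero_le_power2[of "\<eta> - \<delta>"] mult_nonneg_nonneg[OF pos(2,5)]
      by (simp only: power2_diff)
    then have "K * (\<eta> * \<delta>) \<le> K * (\<eta>\<^sup>2 + \<delta>\<^sup>2)" using pos by (intro mult_left_mono) auto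
    ultimately show ?thesis by (simp add: algebra_simps)
  qed
  finally show ?thesis by (simp only: y_def q_def power_mult_distrib)
qed

section \<open>The energy of the logarithm\<close>

lemma set_lebesgue_integral_restrict:
  fixes f :: "'a::euclidean_space \<Rightarrow> real"
  assumes "f absolutely_integrable_on K" "K \<subseteq> S" "\<And>x. x \<in> S - K \<Longrightarrow> f x = 0"
  shows "(LINT x:S|lebesgue. f x) = integral K f"
proof -
  have "indicator S x *\<^sub>R f x = indicator K x *\<^sub>R f x" for x
    using assms by (cases "x \<in> K") (auto simp: indicator_def)
  then have "(LINT x:S|lebesgue. f x) = (LINT x:K|lebesgue. f x)"
    unfolding set_lebesgue_integral_def by presburger
  then show ?thesis using set_lebesgue_integral_eq_integral(2)[OF assms(1)] by simp
qed

lemma absolutely_integrable_times_continuous: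
  fixes h :: "'a::euclidean_space \<Rightarrow> 'b::euclidean_space \<Rightarrow> real"
  assumes "bilinear h" "compact K" "f absolutely_integrable_on K" "continuous_on K g"
  shows "(\<lambda>x. h (f x) (g x)) absolutely_integrable_on K"
proof -
  have K: "K \<in> sets lebesgue" using assms(2) lmeasurable_compact fmeasurableD by blast
  have "g \<in> borel_measurable (lebesgue_on K)"
    using assms K by (simp add: continuous_imp_measurable_on_sets_lebesgue)
  moreover have "bounded (g ` K)"
    using assms by (simp add: compact_continuous_image compact_imp_bounded)
  moreover have "bilinear (\<lambda>x y. h y x)" using assms(1) by (simp add: bilinear_def)
  ultimately show ?thesis
    using absolutely_integrable_bounded_measurable_product[of "\<lambda>x y. h y x" g K f] K assms by blast
qed

text \<open>
  Subtracting the two weak inequalities is legitimate only because all four integrals exist; the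
  local integrability in the notion of weak solution supplies this on the compact set \<open>K\<close>, which
  contains the support of the test function.
\<close>

lemma weak_difference_inequality:
  fixes A :: "real ^ 'n \<Rightarrow> real \<Rightarrow> real ^ 'n \<Rightarrow> real ^ 'n"
  assumes u: "weak_solution_ge \<Omega> A B u" and v: "weak_solution_le \<Omega> A B v"
    and \<psi>: "test_function \<Omega> \<psi>" "continuous_on K \<psi>" "continuous_on K (grad \<psi>)"
    and K: "compact K" "K \<subseteq> \<Omega>"
    and out: "\<And>x. x \<in> \<Omega> - K \<Longrightarrow> \<psi> x = 0" "\<And>x. x \<in> \<Omega> - K \<Longrightarrow> grad \<psi> x = 0"
  defines "F \<equiv> \<lambda>x. (A x (v x) (grad v x) - A x (u x) (grad u x)) \<bullet> grad \<psi> x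
      - (B x (v x) (grad v x) - B x (u x) (grad u x)) * \<psi> x"
  shows "F integrable_on K" and "0 \<le> integral K F"
proof -
  have bil: "bilinear ((\<bullet>) :: real ^ 'n \<Rightarrow> _)" "bilinear ((*) :: real \<Rightarrow> _)"
    by (simp_all add: bilinear_conv_bounded_bilinear bounded_bilinear_inner bounded_bilinear_mult)
  define Av where "Av = (\<lambda>x. A x (v x) (grad v x) \<bullet> grad \<psi> x)"
  define Au where "Au = (\<lambda>x. A x (u x) (grad u x) \<bullet> grad \<psi> x)"
  define Bv where "Bv = (\<lambda>x. B x (v x) (grad v x) * \<psi> x)"
  define Bu where "Bu = (\<lambda>x. B x (u x) (grad u x) * \<psi> x)"
  note defs = Av_def Au_def Bv_def Bu_def
  have "(\<lambda>x. A x (v x) (grad v x)) absolutely_integrable_on K"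
    "(\<lambda>x. A x (u x) (grad u x)) absolutely_integrable_on K"
    "(\<lambda>x. B x (v x) (grad v x)) absolutely_integrable_on K"
    "(\<lambda>x. B x (u x) (grad u x)) absolutely_integrable_on K"
    using u v K unfolding weak_solution_ge_def weak_solution_le_def L1_loc_def by blast+
  then have abs: "Av absolutely_integrable_on K" "Au absolutely_integrable_on K"
    "Bv absolutely_integrable_on K" "Bu absolutely_integrable_on K"
    unfolding defs
    using absolutely_integrable_times_continuous[OF bil(1) K(1) _ \<psi>(3)]
      absolutely_integrable_times_continuous[OF bil(2) K(1) _ \<psi>(2)] by simp_all
  have zero: "Av x = 0" "Au x = 0" "Bv x = 0" "Bu x = 0" if "x \<in> \<Omega> - K" for x
    unfolding defs using out[OF that] by simp_all
  note eq = set_lebesgue_integral_restrict[OF abs(1) K(2) zero(1)]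
    set_lebesgue_integral_restrict[OF abs(2) K(2) zero(2)]
    set_lebesgue_integral_restrict[OF abs(3) K(2) zero(3)]
    set_lebesgue_integral_restrict[OF abs(4) K(2) zero(4)]
  have "(LINT x:\<Omega>|lebesgue. Au x) \<le> (LINT x:\<Omega>|lebesgue. Bu x)"
    using u \<psi>(1) by (simp add: weak_solution_ge_def defs)
  moreover have "(LINT x:\<Omega>|lebesgue. Bv x) \<le> (LINT x:\<Omega>|lebesgue. Av x)"
    using v \<psi>(1) by (simp add: weak_solution_le_def defs)
  ultimately have le: "integral K Au \<le> integral K Bu" "integral K Bv \<le> integral K Av"
    by (simp_all only: eq)
  have int: "Av integrable_on K" "Au integrable_on K" "Bv integrable_on K" "Bu integrable_on K"
    using abs by (simp_all add: set_lebesgue_integral_eq_integral(1))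
  have F: "F = (\<lambda>x. (Av x - Au x) - (Bv x - Bu x))"
    unfolding F_def defs by (simp add: inner_diff_left left_diff_distrib)
  show "F integrable_on K" unfolding F by (intro integrable_diff int)
  have "integral K F = (integral K Av - integral K Au) - (integral K Bv - integral K Bu)"
    unfolding F by (simp add: Henstock_Kurzweil_Integration.integral_diff integrable_diff int)
  with le show "0 \<le> integral K F" by simp
qed

text \<open>
  The Caccioppoli estimate for \<open>log w\<close>: integrate the pointwise inequality with \<open>\<delta> = 4 r\<close>, the
  bound for the gradient of the bump, and \<open>\<eta> \<le> r\<^sup>2 \<le> r\<close>.
\<close>

lemma log_energy_estimate:
  fixes w :: "'a::euclidean_space \<Rightarrow> real"
  assumes box: "cbox a b \<subseteq> U" and r: "0 < r" "r \<le> 1"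
    and w: "\<And>x. x \<in> U \<Longrightarrow> 0 < w x" "continuous_on U w" "continuous_on U p"
    and const: "0 \<le> K" "0 \<le> bz" "0 \<le> L"
    and coercive: "\<And>x. x \<in> U \<Longrightarrow> P x \<bullet> p x \<ge> (norm (p x))\<^sup>2 / 2 - K * w x * norm (p x)"
    and growth: "\<And>x. x \<in> U \<Longrightarrow> norm (P x) \<le> K * (norm (p x) + w x)"
    and lower: "\<And>x. x \<in> U \<Longrightarrow> \<beta> x \<ge> - bz * w x - L * norm (p x)"
    and int: "(\<lambda>x. P x \<bullet> quotient_grad c r w p x - \<beta> x * (bump c r x / w x)) integrable_on cbox a b"
    and nonneg: "0 \<le> integral (cbox a b)
      (\<lambda>x. P x \<bullet> quotient_grad c r w p x - \<beta> x * (bump c r x / w x))"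
  defines "C \<equiv> 4 * ((2 * K\<^sup>2 + K) * 16 + (2 * (K + L)\<^sup>2 + K + bz))"
  shows "integral (cbox a b) (\<lambda>x. bump c r x * (norm (p x) / w x)\<^sup>2) \<le> C * r\<^sup>2 * measure lborel (cbox a b)"
proof -
  let ?F = "\<lambda>x. P x \<bullet> quotient_grad c r w p x - \<beta> x * (bump c r x / w x)"
  let ?H = "\<lambda>x. bump c r x * (norm (p x) / w x)\<^sup>2"
  have F: "?F x \<le> - (?H x / 4) + C * r\<^sup>2 / 4" if x: "x \<in> cbox a b" for x
  proof -
    have xU: "x \<in> U" using x box by auto
    define \<eta> where "\<eta> = max 0 (r\<^sup>2 - (norm (x - c))\<^sup>2)"
    have \<eta>: "0 \<le> \<eta>" "bump c r x = \<eta>\<^sup>2" "bump_grad c r x = (- 4 * \<eta>) *\<^sub>R (x - c)"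
      by (auto simp: \<eta>_def bump_def bump_grad_def)
    have le: "\<eta> * norm (x - c) \<le> \<eta> * r"
    proof (cases "norm (x - c) \<le> r")
      case True
      then show ?thesis using \<eta> by (simp add: mult_left_mono)
    next
      case False
      then have "\<eta> = 0" using r power_strict_mono[of r "norm (x - c)" 2] by (simp add: \<eta>_def)
      then show ?thesis by simp
    qed
    have "norm (bump_grad c r x) \<le> \<eta> * (4 * r)"
      using le \<eta>(1) by (simp add: \<eta>(3))
    then have "P x \<bullet> ((1 / w x) *\<^sub>R bump_grad c r x - (\<eta>\<^sup>2 / (w x)\<^sup>2) *\<^sub>R p x)
        + (bz * w x + L * norm (p x)) * (\<eta>\<^sup>2 / w x)
      \<le> - (\<eta>\<^sup>2 * (norm (p x) / w x)\<^sup>2) / 4 + (2 * K\<^sup>2 + K) * (4 * r)\<^sup>2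
        + (2 * (K + L)\<^sup>2 + K + bz) * \<eta>\<^sup>2"
      by (intro log_energy_pointwise w xU const coercive growth \<eta>) (use r const in auto)
    moreover have "- \<beta> x * (\<eta>\<^sup>2 / w x) \<le> (bz * w x + L * norm (p x)) * (\<eta>\<^sup>2 / w x)"
      using lower[OF xU] w(1)[OF xU] by (intro mult_right_mono) auto
    moreover have "\<eta>\<^sup>2 \<le> r\<^sup>2"
    proof -
      have "r\<^sup>2 \<le> r" using r by (simp add: power2_eq_square mult_left_le)
      moreover have "\<eta> \<le> r\<^sup>2" by (simp add: \<eta>_def)
      ultimately show ?thesis using \<eta>(1) by (intro power_mono) auto
    qed
    then have "(2 * (K + L)\<^sup>2 + K + bz) * \<eta>\<^sup>2 \<le> (2 * (K + L)\<^sup>2 + K + bz) * r\<^sup>2"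
      using const by (intro mult_left_mono) auto
    ultimately show ?thesis
      unfolding quotient_grad_def \<eta>(2) C_def by (simp add: algebra_simps power_mult_distrib)
  qed
  have H: "?H integrable_on cbox a b"
  proof (intro integrable_continuous continuous_intros ballI)
    show "continuous_on (cbox a b) p" "continuous_on (cbox a b) w"
      using w(2,3) box continuous_on_subset by blast+
    show "w x \<noteq> 0" if "x \<in> cbox a b" for x
      using w(1)[of x] that box by auto
  qed
  have "0 \<le> integral (cbox a b) (\<lambda>x. - (?H x / 4) + C * r\<^sup>2 / 4)"
    by (rule order_trans[OF nonneg], rule integral_le[OF int _ F])
       (intro integrable_add integrable_const integrable_neg integrable_on_divide H)
  also have "\<dots> = - (integral (cbox a b) ?H / 4) + C * r\<^sup>2 / 4 * measure lborel (cbox a b)"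
    using H by (subst integral_add) (auto intro: integrable_neg integrable_on_divide)
  finally show ?thesis by simp
qed

section \<open>Means of the logarithm on shrinking boxes\<close>

lemma integral_rescale_box:
  fixes f :: "'a::euclidean_space \<Rightarrow> real"
  assumes "f integrable_on cbox (x0 + s *\<^sub>R a) (x0 + s *\<^sub>R b)" "0 < s"
  shows "integral (cbox a b) (\<lambda>y. f (x0 + s *\<^sub>R y))
    = integral (cbox (x0 + s *\<^sub>R a) (x0 + s *\<^sub>R b)) f / s ^ DIM('a)"
proof -
  have "((\<lambda>y. f (s *\<^sub>R y + x0)) has_integral
      integral (cbox (x0 + s *\<^sub>R a) (x0 + s *\<^sub>R b)) f /\<^sub>R s ^ DIM('a))
     (cbox ((x0 + s *\<^sub>R a - x0) /\<^sub>R s) ((x0 + s *\<^sub>R b - x0) /\<^sub>R s))"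
    using has_integral_affinity'[OF integrable_integral[OF assms(1)] assms(2)] .
  then show ?thesis
    using assms(2) by (simp add: add.commute integral_unique divide_inverse mult.commute)
qed

lemma mem_box_rescale_iff:
  fixes x0 :: "'a::euclidean_space"
  assumes "0 < s"
  shows "x0 + s *\<^sub>R y \<in> cbox (x0 + s *\<^sub>R a) (x0 + s *\<^sub>R b) \<longleftrightarrow> y \<in> cbox a b"
  using assms by (simp add: mem_box inner_add_left)

lemma content_rescale_box:
  fixes a b x0 :: "'a::euclidean_space"
  assumes "0 < s"
  shows "measure lborel (cbox (x0 + s *\<^sub>R a) (x0 + s *\<^sub>R b)) = s ^ DIM('a) * measure lborel (cbox a b)"
  using integral_rescale_box[of "\<lambda>_. 1" x0 s a b] assms by (simp add: field_simps integrable_const)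

text \<open>
  The derivative in \<open>s\<close> of the mean of \<open>log w\<close> over the box scaled by \<open>s\<close> is the integral of
  \<open>\<phi> (p \<bullet> y) / w\<close>, at most \<open>\<rho>\<close> times the integral of \<open>\<phi> q\<close> with \<open>q = |p| / w\<close>. Since
  \<open>s q \<le> (1 + (s q)\<^sup>2) / 2\<close>, the scale-invariant energy bound makes it at most \<open>M / s\<close>. Integration
  from \<open>s\<close> to a fixed scale shows that the mean falls no faster than \<open>M log s\<close>.
\<close>

lemma log_mean_lower_bound:
  fixes w :: "'a::euclidean_space \<Rightarrow> real"
  assumes s0: "0 < s0" and U: "open U"
    and sub: "\<And>s y. 0 < s \<Longrightarrow> s < s0 \<Longrightarrow> y \<in> cbox a b \<Longrightarrow> x0 + s *\<^sub>R y \<in> U"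
    and w: "\<And>x. x \<in> U \<Longrightarrow> 0 < w x"
    and dw: "\<And>x. x \<in> U \<Longrightarrow> (w has_derivative (\<lambda>h. p x \<bullet> h)) (at x)"
    and p: "continuous_on U p"
    and \<phi>: "continuous_on (cbox a b) \<phi>" "\<And>y. y \<in> cbox a b \<Longrightarrow> 0 \<le> \<phi> y"
    and \<rho>: "\<And>y. y \<in> cbox a b \<Longrightarrow> norm y \<le> \<rho>" "0 \<le> \<rho>"
    and energy: "\<And>s. 0 < s \<Longrightarrow> s < s0 \<Longrightarrow> integral (cbox a b)
       (\<lambda>y. \<phi> y * (s * (norm (p (x0 + s *\<^sub>R y)) / w (x0 + s *\<^sub>R y)))\<^sup>2) \<le> E"
  shows "\<exists>c M. \<forall>s. 0 < s \<longrightarrow> s < s0 / 2 \<longrightarrow>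
    c + M * ln s \<le> integral (cbox a b) (\<lambda>y. \<phi> y * ln (w (x0 + s *\<^sub>R y)))"
proof -
  let ?Q = "cbox a b" and ?V = "{0<..<s0}"
  define I where "I = integral ?Q \<phi>"
  define M where "M = \<rho> / 2 * (I + E)"
  define G where "G s = integral ?Q (\<lambda>y. \<phi> y * ln (w (x0 + s *\<^sub>R y)))" for s
  define fx where "fx s y = \<phi> y * ((p (x0 + s *\<^sub>R y) \<bullet> y) / w (x0 + s *\<^sub>R y))" for s y
  have cw: "continuous_on U w"
    using dw by (meson U continuous_on_eq_continuous_at has_derivative_continuous)
  note [continuous_intros] = continuous_on_compose2[OF cw] continuous_on_compose2[OF p]
    continuous_on_compose2[OF \<phi>(1)]
  have nz: "w (x0 + s *\<^sub>R y) \<noteq> 0" if "0 < s" "s < s0" "y \<in> ?Q" for s y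
    using w[OF sub[OF that]] by simp
  have cont_fx: "continuous_on (?V \<times> ?Q) (\<lambda>(s, y). fx s y)"
    unfolding fx_def split_beta by (intro continuous_intros) (auto simp: sub nz)
  have dG: "(G has_real_derivative integral ?Q (fx s)) (at s)" if s: "s \<in> ?V" for s
  proof -
    have "((\<lambda>s. \<phi> y * ln (w (x0 + s *\<^sub>R y))) has_field_derivative fx s y) (at s within ?V)"
      if "s \<in> ?V" "y \<in> ?Q" for s y
    proof -
      have xU: "x0 + s *\<^sub>R y \<in> U" using sub that by auto
      have "((\<lambda>s. x0 + s *\<^sub>R y) has_derivative (\<lambda>h. h *\<^sub>R y)) (at s)"
        by (auto intro!: derivative_eq_intros)
      from has_derivative_compose[OF this dw[OF xU]]
      have "((\<lambda>s. w (x0 + s *\<^sub>R y)) has_real_derivative (p (x0 + s *\<^sub>R y) \<bullet> y)) (at s)"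
        unfolding has_field_derivative_def by (rule has_derivative_eq_rhs) (auto simp: mult.commute)
      then have "((\<lambda>s. \<phi> y * ln (w (x0 + s *\<^sub>R y))) has_field_derivative fx s y) (at s)"
        unfolding fx_def using w[OF xU] by (auto intro!: derivative_eq_intros)
      then show ?thesis by (rule has_field_derivative_at_within)
    qed
    moreover have "(\<lambda>y. \<phi> y * ln (w (x0 + s *\<^sub>R y))) integrable_on ?Q" if "s \<in> ?V" for s
      using that by (intro integrable_continuous continuous_intros) (auto simp: sub nz)
    ultimately have "(G has_real_derivative integral ?Q (fx s)) (at s within ?V)"
      unfolding G_def by (rule leibniz_rule_field_derivative[OF _ _ cont_fx s]) auto
    then show ?thesis using s by (simp add: at_within_open[of s ?V])
  qed
  have bound: "integral ?Q (fx s) \<le> M / s" if s: "0 < s" "s < s0" for s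
  proof -
    let ?e = "\<lambda>y. \<phi> y * (s * (norm (p (x0 + s *\<^sub>R y)) / w (x0 + s *\<^sub>R y)))\<^sup>2"
    have "fx s y \<le> \<rho> / (2 * s) * (\<phi> y + ?e y)" if y: "y \<in> ?Q" for y
    proof -
      define q where "q = norm (p (x0 + s *\<^sub>R y)) / w (x0 + s *\<^sub>R y)"
      have w0: "0 < w (x0 + s *\<^sub>R y)" using sub s y w by auto
      have q0: "0 \<le> q" using w0 by (simp add: q_def)
      have "p (x0 + s *\<^sub>R y) \<bullet> y \<le> norm (p (x0 + s *\<^sub>R y)) * \<rho>"
        using norm_cauchy_schwarz \<rho>(1)[OF y] by (meson mult_left_mono norm_ge_zero order_trans)
      then have "(p (x0 + s *\<^sub>R y) \<bullet> y) / w (x0 + s *\<^sub>R y) \<le> \<rho> * q"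
        using w0 by (simp add: q_def divide_right_mono mult.commute)
      also have "q \<le> (1 + (s * q)\<^sup>2) / (2 * s)"
        using zero_le_power2[of "1 - s * q"] s by (simp add: field_simps power2_eq_square)
      then have "\<rho> * q \<le> \<rho> * ((1 + (s * q)\<^sup>2) / (2 * s))"
        using \<rho>(2) by (rule mult_left_mono)
      finally have "fx s y \<le> \<phi> y * (\<rho> * ((1 + (s * q)\<^sup>2) / (2 * s)))"
        unfolding fx_def using \<phi>(2)[OF y] by (intro mult_left_mono) auto
      then show ?thesis by (simp add: q_def[symmetric] field_simps)
    qed
    moreover have e: "?e integrable_on ?Q" "\<phi> integrable_on ?Q" "fx s integrable_on ?Q"
      using s unfolding fx_def by (auto intro!: integrable_continuous continuous_intros simp: sub nz \<phi>)
    ultimately have "integral ?Q (fx s) \<le> integral ?Q (\<lambda>y. \<rho> / (2 * s) * (\<phi> y + ?e y))"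
      by (intro integral_le integrable_on_mult_right integrable_add) auto
    also have "\<dots> = \<rho> / (2 * s) * (I + integral ?Q ?e)"
      using e by (simp add: integral_add I_def)
    also have "\<dots> \<le> \<rho> / (2 * s) * (I + E)"
      using energy[OF s] \<rho>(2) s by (intro mult_left_mono) auto
    finally show ?thesis by (simp add: M_def field_simps)
  qed
  define s1 where "s1 = s0 / 2"
  have "G s1 - M * ln s1 + M * ln s \<le> G s" if s: "0 < s" "s < s0 / 2" for s
  proof -
    have "G s1 - M * ln s1 \<le> G s - M * ln s"
    proof (rule DERIV_nonpos_imp_nonincreasing[of s s1 "\<lambda>s. G s - M * ln s"])
      show "s \<le> s1" using s by (simp add: s1_def)
      fix t assume "s \<le> t" "t \<le> s1"
      then have t: "0 < t" "t < s0" using s s0 by (auto simp: s1_def)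
      then have "((\<lambda>s. G s - M * ln s) has_real_derivative integral ?Q (fx t) - M / t) (at t)"
        by (auto intro!: derivative_eq_intros dG)
      then show "\<exists>y. ((\<lambda>s. G s - M * ln s) has_real_derivative y) (at t) \<and> y \<le> 0"
        using bound[OF t] by (metis diff_le_0_iff_le)
    qed
    then show ?thesis by simp
  qed
  then show ?thesis unfolding G_def by blast
qed

text \<open>
  If \<open>w \<le> C s\<^sup>m\<close> on the box at scale \<open>s\<close>, then its logarithmic mean is at most
  \<open>I (log C + m log s)\<close>, where \<open>I\<close> is the integral of \<open>\<phi>\<close>. As \<open>s\<close> tends to \<open>0\<close> this lies below
  \<open>c + M log s\<close> once \<open>m I > M\<close>.
\<close>

lemma log_mean_bound_excludes_powers:
  fixes w :: "'a::euclidean_space \<Rightarrow> real"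
  assumes s0: "0 < s0"
    and pos: "\<And>s y. 0 < s \<Longrightarrow> s < s0 \<Longrightarrow> y \<in> cbox a b \<Longrightarrow> 0 < w (x0 + s *\<^sub>R y)"
    and cont: "\<And>s. 0 < s \<Longrightarrow> s < s0 \<Longrightarrow> continuous_on (cbox a b) (\<lambda>y. w (x0 + s *\<^sub>R y))"
    and \<phi>: "continuous_on (cbox a b) \<phi>" "\<And>y. y \<in> cbox a b \<Longrightarrow> 0 \<le> \<phi> y" "0 < integral (cbox a b) \<phi>"
    and lower: "\<And>s. 0 < s \<Longrightarrow> s < s0 \<Longrightarrow>
       c + M * ln s \<le> integral (cbox a b) (\<lambda>y. \<phi> y * ln (w (x0 + s *\<^sub>R y)))"
    and powers: "\<And>m::nat. \<exists>C s1. 0 < s1 \<and>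
       (\<forall>s y. 0 < s \<longrightarrow> s < s1 \<longrightarrow> y \<in> cbox a b \<longrightarrow> w (x0 + s *\<^sub>R y) \<le> C * s ^ m)"
  shows False
proof -
  define I where "I = integral (cbox a b) \<phi>"
  have I: "0 < I" using \<phi> by (simp add: I_def)
  obtain m :: nat where "(M + 1) / I < m" using reals_Archimedean2 by blast
  then have m: "M + 1 < m * I" using I by (simp add: field_simps)
  from powers[of m] obtain C s1 where s1: "0 < s1"
    and C: "\<And>s y. 0 < s \<Longrightarrow> s < s1 \<Longrightarrow> y \<in> cbox a b \<Longrightarrow> w (x0 + s *\<^sub>R y) \<le> C * s ^ m" by blast
  define C' where "C' = max C 1"
  have C': "0 < C'" "C \<le> C'" by (auto simp: C'_def)
  have key: "c - I * ln C' \<le> ln s" if s: "0 < s" "s < s0" "s < s1" "s < 1" for s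
  proof -
    have "c + M * ln s \<le> integral (cbox a b) (\<lambda>y. \<phi> y * ln (w (x0 + s *\<^sub>R y)))"
      using lower s by simp
    also have "\<dots> \<le> integral (cbox a b) (\<lambda>y. \<phi> y * (ln C' + m * ln s))"
    proof (rule integral_le)
      show "(\<lambda>y. \<phi> y * ln (w (x0 + s *\<^sub>R y))) integrable_on cbox a b"
        using pos s by (intro integrable_continuous continuous_intros \<phi> cont)
          (auto simp: less_imp_neq[THEN not_sym])
      show "(\<lambda>y. \<phi> y * (ln C' + m * ln s)) integrable_on cbox a b"
        by (intro integrable_continuous continuous_intros \<phi>)
      fix y assume y: "y \<in> cbox a b"
      have "w (x0 + s *\<^sub>R y) \<le> C' * s ^ m"
        using C[OF s(1,3) y] C'(2) s(1) by (meson mult_right_mono order_trans zero_le_power less_imp_le)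
      then have "ln (w (x0 + s *\<^sub>R y)) \<le> ln (C' * s ^ m)"
        using pos[OF s(1,2) y] by simp
      also have "\<dots> = ln C' + m * ln s"
        using C' s by (simp add: ln_mult ln_realpow)
      finally show "\<phi> y * ln (w (x0 + s *\<^sub>R y)) \<le> \<phi> y * (ln C' + m * ln s)"
        using \<phi>(2)[OF y] by (rule mult_left_mono)
    qed
    also have "\<dots> = I * (ln C' + m * ln s)" by (simp add: I_def)
    finally have "c - I * ln C' \<le> (m * I - M) * ln s" by (simp add: algebra_simps)
    also have "\<dots> \<le> 1 * ln s" using m s by (intro mult_right_mono_neg) auto
    finally show ?thesis by simp
  qed
  define s where "s = min (min (s0 / 2) (s1 / 2)) (min (1 / 2) (exp (c - I * ln C' - 1)))"
  have s: "0 < s" "s < s0" "s < s1" "s < 1" using s0 s1 by (auto simp: s_def min_less_iff_disj)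
  have "ln s \<le> ln (exp (c - I * ln C' - 1))"
    using s(1) by (subst ln_le_cancel_iff) (auto simp: s_def)
  with key[OF s] show False by simp
qed

section \<open>Behaviour at the apex of the cone\<close>

lemma C1_closure_onD:
  assumes "C1_closure \<Omega> f"
  shows "x \<in> \<Omega> \<Longrightarrow> (f has_derivative (\<lambda>h. grad f x \<bullet> h)) (at x)"
    and "continuous_on \<Omega> (grad f)"
proof -
  show "x \<in> \<Omega> \<Longrightarrow> (f has_derivative (\<lambda>h. grad f x \<bullet> h)) (at x)"
    using assms has_derivative_grad unfolding C1_closure_def by blast
  obtain G where "continuous_on (closure \<Omega>) G" "\<And>x. x \<in> \<Omega> \<Longrightarrow> G x = grad f x"
    using assms unfolding C1_closure_def by blast
  then show "continuous_on \<Omega> (grad f)"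
    by (meson closure_subset continuous_on_eq continuous_on_subset)
qed

lemma grad_tendsto_grad_ext:
  assumes "C1_closure \<Omega> f" "open \<Omega>" "a \<in> frontier \<Omega>"
  shows "(grad f \<longlongrightarrow> grad_ext \<Omega> f a) (at a within \<Omega>)"
proof -
  obtain G where G: "continuous_on (closure \<Omega>) G" "\<And>x. x \<in> \<Omega> \<Longrightarrow> G x = grad f x"
    using assms(1) unfolding C1_closure_def by blast
  have a: "a \<in> closure \<Omega>" "a \<notin> \<Omega>"
    using assms(2,3) by (auto simp: frontier_def interior_open)
  have "(G \<longlongrightarrow> G a) (at a within \<Omega>)"
    using G(1) a(1) closure_subset unfolding continuous_on_def
    by (meson tendsto_within_subset)
  then have lim: "(grad f \<longlongrightarrow> G a) (at a within \<Omega>)"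
    by (rule Lim_transform_eventually) (auto simp: eventually_at_filter G(2))
  have "at a within \<Omega> \<noteq> bot"
    using a by (metis closure_def UnE trivial_limit_within mem_Collect_eq)
  from tendsto_Lim[OF this lim] lim show ?thesis by (simp add: grad_ext_def)
qed

text \<open>
  A cone contains all small multiples of a fixed ball around its axis direction, which is all that
  the scaling argument uses. The radius \<open>\<rho> = (1 - cos \<theta>) / 4\<close> makes the defining inequality of the
  cone strict, so that these points are interior.
\<close>

lemma interior_cone_atD:
  fixes a :: "real ^ 'n"
  assumes "interior_cone_at \<Omega> a \<Omega>b"
  obtains e \<rho> s0 where "norm e = 1" "0 < \<rho>" "\<rho> \<le> 1" "0 < s0"
    "\<And>s y. 0 < s \<Longrightarrow> s < s0 \<Longrightarrow> norm (y - e) \<le> \<rho> \<Longrightarrow> a + s *\<^sub>R y \<in> \<Omega>b"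
proof -
  obtain e \<theta> h where e: "norm e = 1" and \<theta>: "0 < \<theta>" "\<theta> < pi / 2" and h: "0 < h"
    and \<Omega>b: "\<Omega>b = interior (finite_cone a e \<theta> h)"
    using assms unfolding interior_cone_at_def by blast
  define k where "k = cos \<theta>"
  have k: "0 \<le> k" "k < 1"
    using \<theta> cos_gt_zero[of \<theta>] cos_monotone_0_pi[of 0 \<theta>] by (auto simp: k_def)
  define \<rho> where "\<rho> = (1 - k) / 4"
  have \<rho>: "0 < \<rho>" "\<rho> \<le> 1" using k by (auto simp: \<rho>_def)
  have "a + s *\<^sub>R y \<in> \<Omega>b" if s: "0 < s" "s < h / 2" and y: "norm (y - e) \<le> \<rho>" for s y
  proof -
    let ?T = "{x. cos \<theta> * norm (x - a) < (x - a) \<bullet> e} \<inter> {x. (x - a) \<bullet> e < h}"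
    have "open ?T" by (intro open_Int open_Collect_less continuous_intros)
    moreover have "?T \<subseteq> finite_cone a e \<theta> h" by (auto simp: finite_cone_def)
    ultimately have T: "?T \<subseteq> \<Omega>b" unfolding \<Omega>b by (simp add: interior_maximal)
    have ye: "\<bar>(y - e) \<bullet> e\<bar> \<le> \<rho>"
      using Cauchy_Schwarz_ineq2[of "y - e" e] e y by simp
    then have "1 - \<rho> \<le> y \<bullet> e" "y \<bullet> e \<le> 1 + \<rho>"
      using e by (auto simp: inner_diff_left norm_eq_1)
    have "norm y \<le> 1 + \<rho>"
      using norm_triangle_sub[of y e] e y by simp
    then have "k * norm y \<le> k * (1 + \<rho>)" using k by (intro mult_left_mono) auto
    have "4 * \<rho> = 1 - k" by (simp add: \<rho>_def)
    then have "k + \<rho> < 1 - \<rho>" using k(2) by linarith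
    moreover have "k * \<rho> \<le> \<rho>" using k \<rho> by (intro mult_left_le_one_le) auto
    ultimately have "k * (1 + \<rho>) < 1 - \<rho>" by (simp add: distrib_left)
    with \<open>k * norm y \<le> k * (1 + \<rho>)\<close> \<open>1 - \<rho> \<le> y \<bullet> e\<close> \<open>y \<bullet> e \<le> 1 + \<rho>\<close>
    have 1: "k * norm y < y \<bullet> e" and 2: "y \<bullet> e \<le> 2" using \<rho> by auto
    have "s * (k * norm y) < s * (y \<bullet> e)" using s 1 by simp
    moreover have "s * (y \<bullet> e) \<le> s * 2" using s 2 by simp
    then have "s * (y \<bullet> e) < h" using s by linarith
    ultimately have "a + s *\<^sub>R y \<in> ?T" using s by (simp add: k_def mult.left_commute)
    with T show ?thesis by blast
  qed
  with that[of e \<rho> "h / 2"] e \<rho> h show thesis by auto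
qed

text \<open>
  By l'Hospital's rule the difference quotient of \<open>w\<close> at the apex along a ray with direction \<open>y\<close>
  tends to \<open>g \<bullet> y\<close>, while the quadratic bound sends it to \<open>0\<close>. So \<open>g\<close> is orthogonal to a whole
  ball of directions.
\<close>

lemma gradient_limit_zero_of_quadratic_bound:
  fixes w :: "'a::real_inner \<Rightarrow> real"
  assumes pos: "0 < s0" "0 < \<rho>"
    and dw: "\<And>s y. 0 < s \<Longrightarrow> s < s0 \<Longrightarrow> norm (y - e) \<le> \<rho> \<Longrightarrow>
        (w has_derivative (\<lambda>h. p (x0 + s *\<^sub>R y) \<bullet> h)) (at (x0 + s *\<^sub>R y))"
    and bound: "\<And>s y. 0 < s \<Longrightarrow> s < s0 \<Longrightarrow> norm (y - e) \<le> \<rho> \<Longrightarrow> \<bar>w (x0 + s *\<^sub>R y)\<bar> \<le> C * s\<^sup>2"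
    and lim: "\<And>y. norm (y - e) \<le> \<rho> \<Longrightarrow> ((\<lambda>s. p (x0 + s *\<^sub>R y)) \<longlongrightarrow> g) (at_right 0)"
  shows "g = 0"
proof -
  have orth: "g \<bullet> y = 0" if y: "norm (y - e) \<le> \<rho>" for y
  proof -
    let ?f = "\<lambda>s. w (x0 + s *\<^sub>R y)"
    have ev: "\<forall>\<^sub>F s in at_right 0. 0 < s \<and> s < s0"
      using pos(1) by (auto simp: eventually_at_right_field)
    have f0: "(?f \<longlongrightarrow> 0) (at_right 0)"
    proof (rule Lim_null_comparison)
      show "\<forall>\<^sub>F s in at_right 0. norm (?f s) \<le> C * s\<^sup>2"
        using ev by eventually_elim (simp add: bound y)
      show "((\<lambda>s. C * s\<^sup>2) \<longlongrightarrow> 0) (at_right 0)"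
        by (rule tendsto_eq_intros refl | simp)+
    qed
    have df: "\<forall>\<^sub>F s in at_right 0. (?f has_real_derivative (p (x0 + s *\<^sub>R y) \<bullet> y)) (at s)"
      using ev
    proof eventually_elim
      case (elim s)
      have "((\<lambda>s. x0 + s *\<^sub>R y) has_derivative (\<lambda>h. h *\<^sub>R y)) (at s)"
        by (auto intro!: derivative_eq_intros)
      from has_derivative_compose[OF this dw] elim y
      show ?case unfolding has_field_derivative_def
        by (auto elim!: has_derivative_eq_rhs simp: mult.commute)
    qed
    have "((\<lambda>s. ?f s / s) \<longlongrightarrow> g \<bullet> y) (at_right 0)"
    proof (rule lhopital_right_0[OF f0])
      show "((\<lambda>s::real. s) \<longlongrightarrow> 0) (at_right 0)" by (rule tendsto_ident_at)
      show "\<forall>\<^sub>F s in at_right (0::real). ((\<lambda>s. s) has_real_derivative 1) (at s)" by simp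
      show "((\<lambda>s. (p (x0 + s *\<^sub>R y) \<bullet> y) / 1) \<longlongrightarrow> g \<bullet> y) (at_right 0)"
        using tendsto_inner[OF lim[OF y] tendsto_const[of y]] by simp
    qed (use df ev in \<open>auto elim: eventually_mono\<close>)
    moreover have "((\<lambda>s. ?f s / s) \<longlongrightarrow> 0) (at_right 0)"
    proof (rule Lim_null_comparison)
      show "\<forall>\<^sub>F s in at_right 0. norm (?f s / s) \<le> C * s"
        using ev
      proof eventually_elim
        case (elim s)
        then show ?case using bound[of s y] y by (simp add: field_simps power2_eq_square)
      qed
      show "((\<lambda>s. C * s) \<longlongrightarrow> 0) (at_right 0)"
        by (rule tendsto_eq_intros refl | simp)+
    qed
    ultimately show ?thesis by (metis tendsto_unique trivial_limit_at_right_real)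
  qed
  show ?thesis
  proof (rule ccontr)
    assume g: "g \<noteq> 0"
    have "g \<bullet> (e + (\<rho> / norm g) *\<^sub>R g) = 0" using pos g by (intro orth) simp
    moreover have "g \<bullet> e = 0" using pos by (intro orth) simp
    ultimately have "\<rho> / norm g * (g \<bullet> g) = 0" by (simp add: inner_add_right)
    then show False using g pos by simp
  qed
qed

section \<open>The linearized operator\<close>

lemma norm_matrix_vector_mult_le:
  fixes M :: "real ^ 'n ^ 'm"
  shows "norm (M *v h) \<le> norm M * norm h"
proof -
  have "norm (M *v h) = L2_set (\<lambda>i. \<bar>M $ i \<bullet> h\<bar>) UNIV"
    by (simp add: norm_vec_def matrix_vector_mul_component)
  also have "\<dots> \<le> L2_set (\<lambda>i. norm (M $ i) * norm h) UNIV"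
    by (intro L2_set_mono) (auto simp: Cauchy_Schwarz_ineq2)
  also have "\<dots> = norm M * norm h"
    by (simp add: norm_vec_def[of M] L2_set_left_distrib)
  finally show ?thesis .
qed

text \<open>
  First \<open>z\<close> varies at the gradient \<open>\<eta>2\<close>, then the gradient varies at \<open>z1\<close>. Ellipticity
  is available along one of the two solutions only, so the linearization is taken at its value
  \<open>(z1, \<eta>1)\<close>, and the oscillation of \<open>A\<^sub>\<eta>\<close> along the segment is the error.
\<close>

lemma flux_difference_linearization:
  fixes A :: "real ^ 'n \<Rightarrow> real \<Rightarrow> real ^ 'n \<Rightarrow> real ^ 'n"
  assumes A: "C1_in_z_eta \<Omega> A" "x \<in> \<Omega>"
    and N: "convex N" "\<eta>1 \<in> N" "\<eta>2 \<in> N"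
    and Z: "convex Z" "z1 \<in> Z" "z2 \<in> Z"
    and Kz: "\<And>z. z \<in> Z \<Longrightarrow> norm (deriv_z A x z \<eta>2) \<le> Kz"
    and osc: "\<And>\<eta>. \<eta> \<in> closed_segment \<eta>1 \<eta>2 \<Longrightarrow>
      norm (deriv_eta A x z1 \<eta> - deriv_eta A x z1 \<eta>1) \<le> \<epsilon>"
  shows "norm (A x z2 \<eta>2 - A x z1 \<eta>1 - deriv_eta A x z1 \<eta>1 *v (\<eta>2 - \<eta>1))
    \<le> Kz * \<bar>z2 - z1\<bar> + \<epsilon> * norm (\<eta>2 - \<eta>1)"
proof -
  have dz: "((\<lambda>t. A x t \<eta>) has_vector_derivative deriv_z A x z \<eta>) (at z)" for z \<eta>
    using A unfolding C1_in_z_eta_def deriv_z_def by (simp add: vector_derivative_works)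
  have d\<eta>: "((\<lambda>\<xi>. A x z \<xi>) has_derivative (\<lambda>h. deriv_eta A x z \<eta> *v h)) (at \<eta>)" for z \<eta>
    using A unfolding C1_in_z_eta_def deriv_eta_def by (simp add: jacobian_works)
  have 1: "norm (A x z2 \<eta>2 - A x z1 \<eta>2) \<le> Kz * norm (z2 - z1)"
  proof (rule differentiable_bound[OF Z(1) _ _ Z(3,2), of _ "\<lambda>z h. h *\<^sub>R deriv_z A x z \<eta>2"])
    fix z assume "z \<in> Z"
    show "((\<lambda>z. A x z \<eta>2) has_derivative (\<lambda>h. h *\<^sub>R deriv_z A x z \<eta>2)) (at z within Z)"
      using dz has_vector_derivative_def has_derivative_at_withinI by blast
    show "onorm (\<lambda>h. h *\<^sub>R deriv_z A x z \<eta>2) \<le> Kz"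
      by (rule onorm_le) (use Kz[OF \<open>z \<in> Z\<close>] in \<open>simp add: mult.commute[of Kz] mult_left_mono\<close>)
  qed
  have 2: "norm (A x z1 \<eta>2 - A x z1 \<eta>1 - deriv_eta A x z1 \<eta>1 *v (\<eta>2 - \<eta>1)) \<le> norm (\<eta>2 - \<eta>1) * \<epsilon>"
  proof (rule differentiable_bound_linearization[where S = "closed_segment \<eta>1 \<eta>2" and ?x0.0 = \<eta>1
        and f' = "\<lambda>\<eta> h. deriv_eta A x z1 \<eta> *v h"])
    show "\<eta>1 + t *\<^sub>R (\<eta>2 - \<eta>1) \<in> closed_segment \<eta>1 \<eta>2" if "t \<in> {0..1}" for t
      using that by (auto simp: in_segment algebra_simps intro!: exI[of _ t])
    fix \<eta> assume \<eta>: "\<eta> \<in> closed_segment \<eta>1 \<eta>2"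
    show "((\<lambda>\<xi>. A x z1 \<xi>) has_derivative (\<lambda>h. deriv_eta A x z1 \<eta> *v h)) (at \<eta> within closed_segment \<eta>1 \<eta>2)"
      using d\<eta> has_derivative_at_withinI by blast
    show "onorm ((\<lambda>h. deriv_eta A x z1 \<eta> *v h) - (\<lambda>h. deriv_eta A x z1 \<eta>1 *v h)) \<le> \<epsilon>"
      unfolding fun_diff_def
    proof (rule onorm_le)
      fix h
      have "norm ((deriv_eta A x z1 \<eta> - deriv_eta A x z1 \<eta>1) *v h)
        \<le> norm (deriv_eta A x z1 \<eta> - deriv_eta A x z1 \<eta>1) * norm h"
        by (rule norm_matrix_vector_mult_le)
      also have "\<dots> \<le> \<epsilon> * norm h" using osc[OF \<eta>] by (simp add: mult_right_mono)
      finally show "norm (deriv_eta A x z1 \<eta> *v h - deriv_eta A x z1 \<eta>1 *v h) \<le> \<epsilon> * norm h"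
        by (simp add: matrix_vector_mult_diff_rdistrib)
    qed
  qed auto
  have "A x z2 \<eta>2 - A x z1 \<eta>1 - deriv_eta A x z1 \<eta>1 *v (\<eta>2 - \<eta>1)
    = (A x z2 \<eta>2 - A x z1 \<eta>2) + (A x z1 \<eta>2 - A x z1 \<eta>1 - deriv_eta A x z1 \<eta>1 *v (\<eta>2 - \<eta>1))"
    by simp
  also have "norm \<dots> \<le> norm (A x z2 \<eta>2 - A x z1 \<eta>2)
      + norm (A x z1 \<eta>2 - A x z1 \<eta>1 - deriv_eta A x z1 \<eta>1 *v (\<eta>2 - \<eta>1))"
    by (rule norm_triangle_ineq)
  finally show ?thesis using 1 2 by (simp add: mult.commute)
qed

text \<open>
  An error of at most half the gradient costs only half of the ellipticity constant \<open>1\<close>.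
\<close>

lemma elliptic_perturbation:
  fixes M :: "real ^ 'n ^ 'n"
  assumes ell: "(norm h)\<^sup>2 \<le> (\<Sum>i\<in>UNIV. \<Sum>j\<in>UNIV. M $ i $ j * h $ i * h $ j)"
    and M: "norm M \<le> Ka" and w: "0 \<le> w" and K: "0 \<le> Kz"
    and lin: "norm (P - M *v h) \<le> Kz * w + 1 / 2 * norm h"
  shows "P \<bullet> h \<ge> (norm h)\<^sup>2 / 2 - (Ka + Kz + 1) * w * norm h"
    and "norm P \<le> (Ka + Kz + 1) * (norm h + w)"
proof -
  have Ka: "0 \<le> Ka" using M norm_ge_zero order_trans by blast
  have "(M *v h) \<bullet> h = (\<Sum>i\<in>UNIV. \<Sum>j\<in>UNIV. M $ i $ j * h $ i * h $ j)"
    by (simp add: inner_vec_def matrix_vector_mult_def sum_distrib_left sum_distrib_right mult_ac)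
  then have 1: "(norm h)\<^sup>2 \<le> (M *v h) \<bullet> h" using ell by simp
  have "\<bar>(P - M *v h) \<bullet> h\<bar> \<le> norm (P - M *v h) * norm h" by (rule Cauchy_Schwarz_ineq2)
  also have "\<dots> \<le> (Kz * w + 1 / 2 * norm h) * norm h" using lin by (simp add: mult_right_mono)
  finally have "P \<bullet> h \<ge> (M *v h) \<bullet> h - (Kz * w + 1 / 2 * norm h) * norm h"
    by (simp add: inner_diff_left abs_le_iff)
  with 1 have "P \<bullet> h \<ge> (norm h)\<^sup>2 / 2 - Kz * w * norm h"
    by (simp add: algebra_simps power2_eq_square)
  moreover have "Kz * w * norm h \<le> (Ka + Kz + 1) * w * norm h"
    using Ka w by (intro mult_right_mono) auto
  ultimately show "P \<bullet> h \<ge> (norm h)\<^sup>2 / 2 - (Ka + Kz + 1) * w * norm h" by linarith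
  have "norm P \<le> norm (P - M *v h) + norm (M *v h)"
    using norm_triangle_ineq[of "P - M *v h" "M *v h"] by simp
  also have "norm (M *v h) \<le> Ka * norm h"
    using norm_matrix_vector_mult_le[of M h] M
    by (meson mult_right_mono norm_ge_zero order_trans)
  finally have "norm P \<le> Kz * w + 1 / 2 * norm h + Ka * norm h" using lin by linarith
  moreover have "0 \<le> Kz * norm h" "0 \<le> Ka * w" using Ka w K by auto
  ultimately show "norm P \<le> (Ka + Kz + 1) * (norm h + w)"
    using w norm_ge_zero[of h] by (simp only: distrib_left distrib_right)
qed

text \<open>
  The estimate of the energy of \<open>log w\<close> is applied on the image of the box under
  \<open>y \<mapsto> x0 + s y\<close>. There the bump is \<open>s\<^sup>4\<close> times the bump on the fixed box, and its radius
  \<open>s R\<close> puts \<open>s\<^sup>2 R\<^sup>2\<close> into the bound; the volume factors \<open>s\<^sup>n\<close> cancel. What remains is the weighted integral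
  of \<open>(s q)\<^sup>2\<close> with \<open>q = |p| / w\<close>, bounded by a constant that is the same at all scales.
\<close>

lemma rescaled_log_energy:
  fixes A :: "real ^ 'n \<Rightarrow> real \<Rightarrow> real ^ 'n \<Rightarrow> real ^ 'n" and B u v x0
    and p P :: "real ^ 'n \<Rightarrow> real ^ 'n"
  defines "w \<equiv> \<lambda>x. v x - u x" and "p \<equiv> \<lambda>x. grad v x - grad u x"
    and "P \<equiv> \<lambda>x. A x (v x) (grad v x) - A x (u x) (grad u x)"
    and "\<beta> \<equiv> \<lambda>x. B x (v x) (grad v x) - B x (u x) (grad u x)"
  assumes C1: "C1_closure \<Omega> u" "C1_closure \<Omega> v"
    and weak: "weak_solution_ge \<Omega> A B u" "weak_solution_le \<Omega> A B v"
    and U: "open U" "U \<subseteq> \<Omega>" and pos: "\<And>x. x \<in> U \<Longrightarrow> 0 < w x"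
    and const: "0 \<le> K" "0 \<le> bz" "0 \<le> L"
    and coercive: "\<And>x. x \<in> U \<Longrightarrow> P x \<bullet> p x \<ge> (norm (p x))\<^sup>2 / 2 - K * w x * norm (p x)"
    and growth: "\<And>x. x \<in> U \<Longrightarrow> norm (P x) \<le> K * (norm (p x) + w x)"
    and lower: "\<And>x. x \<in> U \<Longrightarrow> \<beta> x \<ge> - bz * w x - L * norm (p x)"
    and R: "0 < R" "R \<le> 1" "cball e R \<subseteq> cbox a b"
    and s: "0 < s" "s \<le> 1" and sub: "\<And>y. y \<in> cbox a b \<Longrightarrow> x0 + s *\<^sub>R y \<in> U"
  defines "C \<equiv> 4 * ((2 * K\<^sup>2 + K) * 16 + (2 * (K + L)\<^sup>2 + K + bz))"
  shows "integral (cbox a b) (\<lambda>y. bump e R y * (s * (norm (p (x0 + s *\<^sub>R y)) / w (x0 + s *\<^sub>R y)))\<^sup>2)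
    \<le> C * R\<^sup>2 * measure lborel (cbox a b)"
proof -
  let ?Q = "cbox a b" and ?n = "CARD('n)"
  define c where "c = x0 + s *\<^sub>R e"
  define r where "r = s * R"
  define \<psi> where "\<psi> = (\<lambda>x. bump c r x / w x)"
  define Q' where "Q' = cbox (x0 + s *\<^sub>R a) (x0 + s *\<^sub>R b)"
  have r: "0 < r" "r \<le> 1" using R s by (auto simp: r_def mult_le_one)
  have QU: "Q' \<subseteq> U"
  proof
    fix x assume "x \<in> Q'"
    moreover have x: "x = x0 + s *\<^sub>R ((x - x0) /\<^sub>R s)" using s by simp
    ultimately have "(x - x0) /\<^sub>R s \<in> ?Q"
      using mem_box_rescale_iff[OF s(1)] unfolding Q'_def by metis
    then show "x \<in> U" using sub x by metis
  qed
  have ball: "cball c r \<subseteq> Q'"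
  proof
    fix x assume "x \<in> cball c r"
    then have "norm (x - c) \<le> s * R" by (simp add: dist_norm norm_minus_commute r_def)
    moreover have "x - c = s *\<^sub>R ((x - x0) /\<^sub>R s - e)" using s by (simp add: c_def scaleR_diff_right)
    ultimately have "norm ((x - x0) /\<^sub>R s - e) \<le> R" using s by simp
    then have y: "(x - x0) /\<^sub>R s \<in> ?Q" using R(3) by (auto simp: dist_norm norm_minus_commute)
    have "x = x0 + s *\<^sub>R ((x - x0) /\<^sub>R s)" using s by simp
    then show "x \<in> Q'"
      using mem_box_rescale_iff[OF s(1)] y unfolding Q'_def by metis
  qed
  have dw: "(w has_derivative (\<lambda>h. p x \<bullet> h)) (at x)" if "x \<in> U" for x
    unfolding w_def p_def inner_diff_left
    using that U(2) by (intro has_derivative_diff C1_closure_onD(1)[OF C1(1)] C1_closure_onD(1)[OF C1(2)]) auto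
  have cw: "continuous_on U w"
    using dw by (meson U(1) continuous_on_eq_continuous_at has_derivative_continuous)
  have cp: "continuous_on U p"
    unfolding p_def using C1_closure_onD(2) C1 U(2) continuous_on_subset
    by (intro continuous_on_diff) blast+
  have cU: "cball c r \<subseteq> U" using ball QU by blast
  have \<psi>: "test_function \<Omega> \<psi>" "grad \<psi> = quotient_grad c r w p" "continuous_on Q' \<psi>"
    unfolding \<psi>_def by (rule test_function_bump_quotient[OF U(1) cU r(1) U(2)]; use pos dw cp in blast)+
  have cg: "continuous_on Q' (grad \<psi>)"
    unfolding \<psi>(2)
    by (rule continuous_on_subset[OF continuous_on_quotient_grad[OF U(1) cU r(1) _ cw cp]])
       (auto simp: pos)
  have out: "\<psi> x = 0" "grad \<psi> x = 0" if "x \<in> \<Omega> - Q'" for x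
  proof -
    have "x \<notin> cball c r" using that ball by blast
    then show "\<psi> x = 0" "grad \<psi> x = 0"
      unfolding \<psi>(2) by (simp_all add: \<psi>_def quotient_grad_def bump_eq_0_outside bump_grad_eq_0_outside r
          del: mem_cball)
  qed
  have Q': "compact Q'" "Q' \<subseteq> \<Omega>" using QU U(2) by (auto simp: Q'_def)
  note diff = weak_difference_inequality[OF weak \<psi>(1) \<psi>(3) cg Q' out,
      folded P_def \<beta>_def, unfolded \<psi>(2), unfolded \<psi>_def]
  let ?H = "\<lambda>x. bump c r x * (norm (p x) / w x)\<^sup>2"
  have "integral Q' ?H \<le> C * r\<^sup>2 * measure lborel Q'"
    unfolding C_def Q'_def
    by (rule log_energy_estimate[where U = U and P = P and \<beta> = \<beta>])
       (use QU r pos cw cp const coercive growth lower diff in \<open>auto simp: Q'_def P_def \<beta>_def\<close>)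
  also have "\<dots> = s ^ ?n * (s\<^sup>2 * (C * R\<^sup>2 * measure lborel ?Q))"
    using content_rescale_box[OF s(1), of x0 a b] by (simp add: Q'_def r_def power_mult_distrib)
  finally have 1: "integral Q' ?H / s ^ ?n \<le> s\<^sup>2 * (C * R\<^sup>2 * measure lborel ?Q)"
    using s by (simp add: field_simps)
  have H: "?H integrable_on Q'"
    unfolding Q'_def
  proof (intro integrable_continuous continuous_intros ballI)
    show "continuous_on (cbox (x0 + s *\<^sub>R a) (x0 + s *\<^sub>R b)) p"
      "continuous_on (cbox (x0 + s *\<^sub>R a) (x0 + s *\<^sub>R b)) w"
      using cp cw QU[unfolded Q'_def] continuous_on_subset by blast+
    show "w x \<noteq> 0" if "x \<in> cbox (x0 + s *\<^sub>R a) (x0 + s *\<^sub>R b)" for x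
      using pos[of x] that QU by (auto simp: Q'_def)
  qed
  let ?e = "\<lambda>y. bump e R y * (s * (norm (p (x0 + s *\<^sub>R y)) / w (x0 + s *\<^sub>R y)))\<^sup>2"
  have "?H (x0 + s *\<^sub>R y) = s\<^sup>2 * ?e y" for y
    unfolding c_def r_def bump_scale[OF s(1)] power_mult_distrib by (simp add: algebra_simps)
  then have "s\<^sup>2 * integral ?Q ?e = integral ?Q (\<lambda>y. ?H (x0 + s *\<^sub>R y))"
    by simp
  also have "\<dots> = integral Q' ?H / s ^ ?n"
    using integral_rescale_box[OF H[unfolded Q'_def] s(1)] by (simp add: Q'_def)
  finally have "s\<^sup>2 * integral ?Q ?e \<le> s\<^sup>2 * (C * R\<^sup>2 * measure lborel ?Q)" using 1 by simp
  then show ?thesis using s by simp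
qed

section \<open>The zero has finite order\<close>

lemma infinite_order_zeroD:
  assumes "infinite_order_zero S f a"
  obtains C d where "0 < C" "0 < d"
    "\<And>x. x \<in> S \<Longrightarrow> x \<noteq> a \<Longrightarrow> dist x a < d \<Longrightarrow> \<bar>f x\<bar> \<le> C * norm (x - a) ^ m"
proof -
  have "f \<in> O[at a within S](\<lambda>x. norm (x - a) ^ m)"
    using assms by (simp add: infinite_order_zero_def)
  then obtain C where C: "0 < C" "\<forall>\<^sub>F x in at a within S. norm (f x) \<le> C * norm (norm (x - a) ^ m)"
    by (rule landau_o.bigE)
  then obtain d where "0 < d" "\<forall>x\<in>S. x \<noteq> a \<and> dist x a < d \<longrightarrow> norm (f x) \<le> C * norm (norm (x - a) ^ m)"
    unfolding eventually_at by blast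
  with C(1) that[of C d] show thesis by auto
qed

text \<open>
  Integrals are scaled over boxes, whereas the bump is supported in a ball and the cone contains
  multiples of a ball. The half side length \<open>R = \<rho> / n\<close> keeps the cube inside the larger ball.
\<close>

lemma cube_around:
  fixes e :: "real ^ 'n"
  assumes "0 < \<rho>"
  obtains R a b where "0 < R" "R \<le> \<rho>" "cball e R \<subseteq> cbox a b" "box a b \<noteq> {}"
    "\<And>y. y \<in> cbox a b \<Longrightarrow> norm (y - e) \<le> \<rho>"
proof -
  define R where "R = \<rho> / CARD('n)"
  define a b where "a = (\<chi> i. e $ i - R)" and "b = (\<chi> i. e $ i + R)"
  have card: "1 \<le> real CARD('n)" by (simp add: Suc_leI)
  have R: "0 < R" "R \<le> \<rho>" "real CARD('n) * R = \<rho>"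
    using assms card by (auto simp: R_def field_simps)
  have mem: "y \<in> cbox a b \<longleftrightarrow> (\<forall>i. \<bar>(y - e) $ i\<bar> \<le> R)" for y
  proof -
    have "e $ i - R \<le> y $ i \<and> y $ i \<le> e $ i + R \<longleftrightarrow> \<bar>(y - e) $ i\<bar> \<le> R" for i
      by (simp add: abs_le_iff) linarith
    then show ?thesis by (simp only: mem_box_cart a_def b_def vec_lambda_beta)
  qed
  have "cball e R \<subseteq> cbox a b"
  proof
    fix y assume "y \<in> cball e R"
    then have "norm (y - e) \<le> R" by (simp add: dist_norm norm_minus_commute)
    then show "y \<in> cbox a b"
      unfolding mem using component_le_norm_cart[of "y - e"] by (auto intro: order_trans)
  qed
  moreover have "norm (y - e) \<le> \<rho>" if "y \<in> cbox a b" for y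
  proof -
    have "norm (y - e) \<le> (\<Sum>i\<in>UNIV. \<bar>(y - e) $ i\<bar>)" by (rule norm_le_l1_cart)
    also have "\<dots> \<le> (\<Sum>i\<in>(UNIV :: 'n set). R)" using that unfolding mem by (intro sum_mono) auto
    finally show ?thesis using R(3) by simp
  qed
  moreover have "e \<in> box a b" using R(1) by (simp add: mem_box_cart a_def b_def)
  then have "box a b \<noteq> {}" by blast
  ultimately show thesis using R(1,2) by (intro that[of R a b])
qed

lemma integral_bump_pos:
  fixes e :: "'a::euclidean_space"
  assumes "0 < R" "cball e R \<subseteq> cbox a b" "box a b \<noteq> {}"
  shows "0 < integral (cbox a b) (bump e R)"
proof -
  have int: "bump e R integrable_on cbox a b"
    by (intro integrable_continuous continuous_intros)
  have "integral (cbox a b) (bump e R) \<noteq> 0"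
  proof
    assume "integral (cbox a b) (bump e R) = 0"
    then have "(bump e R has_integral 0) (cbox a b)"
      using integrable_integral[OF int] by simp
    moreover have "e \<in> cbox a b" using assms(1,2) by auto
    ultimately have "bump e R e = 0"
      using has_integral_0_cbox_imp_0[OF continuous_on_bump bump_nonneg _ assms(3)] by blast
    then show False using assms(1) by (simp add: bump_def)
  qed
  moreover have "0 \<le> integral (cbox a b) (bump e R)"
    using int by (intro integral_nonneg) (auto simp: bump_nonneg)
  ultimately show ?thesis by simp
qed

theorem theorem3p1:
  fixes \<Omega> \<Omega>b :: "(real ^ 'n) set" and xb :: "real ^ 'n"
    and A :: "real ^ 'n \<Rightarrow> real \<Rightarrow> real ^ 'n \<Rightarrow> real ^ 'n"
    and B :: "real ^ 'n \<Rightarrow> real \<Rightarrow> real ^ 'n \<Rightarrow> real"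
    and u v :: "real ^ 'n \<Rightarrow> real"
    and Mz M\<eta> bz b\<eta> :: real
  assumes "bounded_domain \<Omega>"
    and "xb \<in> frontier \<Omega>"
    and "interior_cone_at \<Omega> xb \<Omega>b"
    and "C1_closure \<Omega> u" and "C1_closure \<Omega> v"
    and "weak_solution_ge \<Omega> A B u"
    and "weak_solution_le \<Omega> A B v"
    and "continuous_on (\<Omega> \<times> UNIV \<times> UNIV) (\<lambda>(x, z, \<eta>). A x z \<eta>)"
    and "C1_in_z_eta \<Omega> A"
    and "Mz > 0" and "M\<eta> > 0"
    and "\<forall>l. \<bar>grad_ext \<Omega> u xb $ l\<bar> < M\<eta>"
    and "bounded ((\<lambda>(x, z, \<eta>). deriv_z A x z \<eta>) `
           (\<Omega>b \<times> {u xb - Mz .. u xb + Mz} \<times> {\<eta>. \<forall>l. \<eta> $ l \<in> {- M\<eta> .. M\<eta>}}))"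
    and "uniformly_continuous_on
           (\<Omega>b \<times> {u xb - Mz .. u xb + Mz} \<times> {\<eta>. \<forall>l. \<eta> $ l \<in> {- M\<eta> .. M\<eta>}})
           (\<lambda>(x, z, \<eta>). deriv_eta A x z \<eta>)"
    and "bz \<ge> 0" and "b\<eta> \<ge> 0"
    and "\<forall>x\<in>\<Omega>b. \<forall>z1\<in>{u xb - Mz .. u xb + Mz}. \<forall>z2\<in>{u xb - Mz .. u xb + Mz}.
           \<forall>\<eta>1\<in>{\<eta>. \<forall>l. \<eta> $ l \<in> {- M\<eta> .. M\<eta>}}. \<forall>\<eta>2\<in>{\<eta>. \<forall>l. \<eta> $ l \<in> {- M\<eta> .. M\<eta>}}.
             z1 \<ge> z2 \<longrightarrow>
             B x z1 \<eta>1 - B x z2 \<eta>2 \<ge>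
               - bz * (z1 - z2) - b\<eta> * (\<Sum>l\<in>UNIV. \<bar>\<eta>1 $ l - \<eta>2 $ l\<bar>)"
    and "elliptic_in \<Omega>b A u"
    and "\<forall>x\<in>\<Omega>b. u x < v x"
    and "u xb = v xb"
  shows "finite_order_zero (closure \<Omega>) (\<lambda>x. v x - u x) xb"
proof -
  define w where "w = (\<lambda>x. v x - u x)"
  define p where "p = (\<lambda>x. grad v x - grad u x)"
  define Z where "Z = {u xb - Mz .. u xb + Mz}"
  define N where "N = {\<eta>::real ^ 'n. \<forall>l. \<eta> $ l \<in> {- M\<eta> .. M\<eta>}}"
  note H = assms[folded Z_def N_def]
  have \<Omega>: "open \<Omega>" "bounded \<Omega>" using assms(1) by (auto simp: bounded_domain_def)
  have \<Omega>b: "open \<Omega>b" "\<Omega>b \<subseteq> \<Omega>"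
    using assms(3) by (auto simp: interior_cone_at_def)
  have xb: "xb \<notin> \<Omega>" "xb \<in> closure \<Omega>"
    using assms(2) \<Omega>(1) by (auto simp: frontier_def interior_open)
  have N: "N = cbox (\<chi> l. - M\<eta>) (\<chi> l. M\<eta>)"
    by (auto simp: N_def mem_box_cart)
  have "\<not> infinite_order_zero (closure \<Omega>) w xb"
  proof
    assume inf: "infinite_order_zero (closure \<Omega>) w xb"
    obtain e \<rho> s0 where e: "norm e = 1" and \<rho>: "0 < \<rho>" "\<rho> \<le> 1" and s0: "0 < s0"
      and cone: "\<And>s y. 0 < s \<Longrightarrow> s < s0 \<Longrightarrow> norm (y - e) \<le> \<rho> \<Longrightarrow> xb + s *\<^sub>R y \<in> \<Omega>b"
      using interior_cone_atD[OF assms(3)] by blast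
    have norm_y: "norm y \<le> 2" if "norm (y - e) \<le> \<rho>" for y
      using norm_triangle_sub[of y e] e \<rho> that by simp
    have power_bound: "\<exists>C s1. 0 < s1 \<and> (\<forall>s y. 0 < s \<longrightarrow> s < s1 \<longrightarrow> norm (y - e) \<le> \<rho> \<longrightarrow>
        \<bar>w (xb + s *\<^sub>R y)\<bar> \<le> C * s ^ m)" for m
    proof -
      obtain C d where C: "0 < C" "0 < d"
        "\<And>x. x \<in> closure \<Omega> \<Longrightarrow> x \<noteq> xb \<Longrightarrow> dist x xb < d \<Longrightarrow> \<bar>w x\<bar> \<le> C * norm (x - xb) ^ m"
        using infinite_order_zeroD[OF inf, of m] by blast
      have "\<bar>w (xb + s *\<^sub>R y)\<bar> \<le> C * 2 ^ m * s ^ m"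
        if s: "0 < s" "s < min s0 (d / 2)" and y: "norm (y - e) \<le> \<rho>" for s y
      proof -
        have x: "xb + s *\<^sub>R y \<in> \<Omega>" using cone[OF s(1) _ y] s(2) \<Omega>b by auto
        then have ne: "xb + s *\<^sub>R y \<noteq> xb" using xb by metis
        have n: "norm (s *\<^sub>R y) \<le> s * 2" using norm_y[OF y] s(1) by simp
        then have "norm (s *\<^sub>R y) < d" using s(2) by auto
        then have "\<bar>w (xb + s *\<^sub>R y)\<bar> \<le> C * norm (s *\<^sub>R y) ^ m"
          using C(3)[OF subsetD[OF closure_subset x] ne] by (simp add: dist_norm)
        also have "\<dots> \<le> C * (s * 2) ^ m"
          using n C(1) by (intro mult_left_mono power_mono) auto
        finally show ?thesis by (simp add: power_mult_distrib mult_ac)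
      qed
      then show ?thesis using C(2) s0 by (intro exI[of _ "C * 2 ^ m"] exI[of _ "min s0 (d / 2)"]) auto
    qed

    \<comment> \<open>The box conditions on A and B concern both solutions, but only Du(xb) is assumed to lie in
        the box. A zero of order at least two forces Dv(xb) = Du(xb).\<close>
    have dw: "(w has_derivative (\<lambda>h. p x \<bullet> h)) (at x)" if "x \<in> \<Omega>" for x
      unfolding w_def p_def inner_diff_left
      using that by (intro has_derivative_diff C1_closure_onD(1)[OF assms(4)] C1_closure_onD(1)[OF assms(5)])
    have Du: "(grad u \<longlongrightarrow> grad_ext \<Omega> u xb) (at xb within \<Omega>)"
      and Dv: "(grad v \<longlongrightarrow> grad_ext \<Omega> v xb) (at xb within \<Omega>)"
      using grad_tendsto_grad_ext assms(2,4,5) \<Omega>(1) by blast+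
    obtain C2 s2 where s2: "0 < s2" and quadratic: "\<And>s y. 0 < s \<Longrightarrow> s < s2 \<Longrightarrow> norm (y - e) \<le> \<rho> \<Longrightarrow>
        \<bar>w (xb + s *\<^sub>R y)\<bar> \<le> C2 * s\<^sup>2"
      using power_bound[of 2] by blast
    have "grad_ext \<Omega> v xb - grad_ext \<Omega> u xb = 0"
    proof (rule gradient_limit_zero_of_quadratic_bound[where ?s0.0 = "min s0 s2" and \<rho> = \<rho>
            and e = e and ?x0.0 = xb and w = w and p = p and C = C2])
      fix y :: "real ^ 'n" assume y: "norm (y - e) \<le> \<rho>"
      have "((\<lambda>s. xb + s *\<^sub>R y) \<longlongrightarrow> xb) (at_right 0)"
        by (rule tendsto_eq_intros refl | simp)+
      moreover have "\<forall>\<^sub>F s in at_right 0. xb + s *\<^sub>R y \<in> \<Omega> \<and> xb + s *\<^sub>R y \<noteq> xb"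
      proof -
        have "\<forall>\<^sub>F s in at_right 0. 0 < s \<and> s < s0"
          using s0 by (auto simp: eventually_at_right_field)
        then show ?thesis
        proof eventually_elim
          case (elim s)
          then have "xb + s *\<^sub>R y \<in> \<Omega>" using cone y \<Omega>b by blast
          then show ?case using xb by metis
        qed
      qed
      ultimately have ray: "filterlim (\<lambda>s. xb + s *\<^sub>R y) (at xb within \<Omega>) (at_right 0)"
        by (simp add: filterlim_at)
      show "((\<lambda>s. p (xb + s *\<^sub>R y)) \<longlongrightarrow> grad_ext \<Omega> v xb - grad_ext \<Omega> u xb) (at_right 0)"
        unfolding p_def
        by (intro tendsto_diff filterlim_compose[OF Du ray] filterlim_compose[OF Dv ray])
    next
      fix s y assume "0 < s" "s < min s0 s2" "norm (y - e) \<le> \<rho>"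
      then show "(w has_derivative (\<lambda>h. p (xb + s *\<^sub>R y) \<bullet> h)) (at (xb + s *\<^sub>R y))"
        and "\<bar>w (xb + s *\<^sub>R y)\<bar> \<le> C2 * s\<^sup>2"
        using cone quadratic \<Omega>b by (auto intro!: dw)
    qed (use s0 s2 \<rho> in auto)
    then have same_grad: "grad_ext \<Omega> v xb = grad_ext \<Omega> u xb" by simp

    obtain Kz where Kz: "0 < Kz"
      "\<forall>q \<in> (\<lambda>(x, z, \<eta>). deriv_z A x z \<eta>) ` (\<Omega>b \<times> Z \<times> N). norm q \<le> Kz"
      using H(13) unfolding bounded_pos by blast
    have Kz_bound: "norm (deriv_z A x z \<eta>) \<le> Kz" if "x \<in> \<Omega>b" "z \<in> Z" "\<eta> \<in> N" for x z \<eta>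
      using bspec[OF Kz(2) imageI[of "(x, z, \<eta>)"]] that by simp
    have "bounded (\<Omega>b \<times> Z \<times> N)"
      using \<Omega>(2) \<Omega>b(2) bounded_subset by (intro bounded_Times) (auto simp: Z_def N)
    with H(14) have "bounded ((\<lambda>(x, z, \<eta>). deriv_eta A x z \<eta>) ` (\<Omega>b \<times> Z \<times> N))"
      by (rule bounded_uniformly_continuous_image)
    then obtain Ka where Ka: "0 < Ka"
      "\<forall>q \<in> (\<lambda>(x, z, \<eta>). deriv_eta A x z \<eta>) ` (\<Omega>b \<times> Z \<times> N). norm q \<le> Ka"
      unfolding bounded_pos by blast
    have Ka_bound: "norm (deriv_eta A x z \<eta>) \<le> Ka" if "x \<in> \<Omega>b" "z \<in> Z" "\<eta> \<in> N" for x z \<eta>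
      using bspec[OF Ka(2) imageI[of "(x, z, \<eta>)"]] that by simp
    \<comment> \<open>Uniform continuity at tolerance 1/2: the linearization error must stay below half of the
        ellipticity constant 1.\<close>
    obtain \<delta> where \<delta>: "0 < \<delta>" and uc: "\<forall>q\<in>\<Omega>b \<times> Z \<times> N. \<forall>q'\<in>\<Omega>b \<times> Z \<times> N. dist q' q < \<delta> \<longrightarrow>
        dist ((\<lambda>(x, z, \<eta>). deriv_eta A x z \<eta>) q') ((\<lambda>(x, z, \<eta>). deriv_eta A x z \<eta>) q) < 1 / 2"
      using H(14)[unfolded uniformly_continuous_on_def, rule_format, of "1 / 2"] by auto

    have ev_cont: "(f \<longlongrightarrow> f xb) (at xb within \<Omega>)" if "C1_closure \<Omega> f" for f
    proof -
      have "(f \<longlongrightarrow> f xb) (at xb within closure \<Omega>)"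
        using that xb(2) by (simp add: C1_closure_def continuous_on_def)
      then show ?thesis by (rule tendsto_within_subset[OF _ closure_subset])
    qed
    define N0 :: "(real ^ 'n) set" where "N0 = box (\<chi> l. - M\<eta>) (\<chi> l. M\<eta>)"
    have "grad_ext \<Omega> u xb $ l < M\<eta> \<and> - M\<eta> < grad_ext \<Omega> u xb $ l" for l
      using assms(12)[rule_format, of l] by linarith
    then have N0: "open N0" "N0 \<subseteq> N" "grad_ext \<Omega> u xb \<in> N0"
      by (simp_all add: N0_def N mem_box_cart box_subset_cbox open_box)
    have "\<forall>\<^sub>F x in at xb within \<Omega>. u x \<in> Z \<and> v x \<in> Z \<and> grad u x \<in> N \<and> grad v x \<in> N \<and> norm (p x) < \<delta>"
    proof (intro eventually_conj)
      have Zint: "open {u xb - Mz <..< u xb + Mz}" "u xb \<in> {u xb - Mz <..< u xb + Mz}"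
        "{u xb - Mz <..< u xb + Mz} \<subseteq> Z" using assms(10) by (auto simp: Z_def)
      show "\<forall>\<^sub>F x in at xb within \<Omega>. u x \<in> Z"
        by (rule eventually_mono[OF topological_tendstoD[OF ev_cont[OF assms(4)] Zint(1,2)]])
          (use Zint(3) in blast)
      show "\<forall>\<^sub>F x in at xb within \<Omega>. v x \<in> Z"
        by (rule eventually_mono[OF topological_tendstoD[OF ev_cont[OF assms(5)], folded assms(20), OF Zint(1,2)]])
          (use Zint(3) in blast)
      show "\<forall>\<^sub>F x in at xb within \<Omega>. grad u x \<in> N"
        by (rule eventually_mono[OF topological_tendstoD[OF Du N0(1,3)]]) (use N0(2) in blast)
      show "\<forall>\<^sub>F x in at xb within \<Omega>. grad v x \<in> N"
        by (rule eventually_mono[OF topological_tendstoD[OF Dv[unfolded same_grad] N0(1,3)]]) (use N0(2) in blast)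
      have "(p \<longlongrightarrow> 0) (at xb within \<Omega>)"
        using tendsto_diff[OF Dv Du] by (simp add: p_def same_grad)
      from tendstoD[OF this \<delta>] show "\<forall>\<^sub>F x in at xb within \<Omega>. norm (p x) < \<delta>" by simp
    qed
    then obtain d where d: "0 < d" and near: "\<forall>x\<in>\<Omega>. x \<noteq> xb \<and> dist x xb < d \<longrightarrow>
        u x \<in> Z \<and> v x \<in> Z \<and> grad u x \<in> N \<and> grad v x \<in> N \<and> norm (p x) < \<delta>"
      unfolding eventually_at by blast

    define U where "U = \<Omega>b \<inter> ball xb d"
    have U: "open U" "U \<subseteq> \<Omega>" using \<Omega>b by (auto simp: U_def)
    have Uin: "x \<in> \<Omega>b" "x \<in> \<Omega>" "u x \<in> Z" "v x \<in> Z" "grad u x \<in> N" "grad v x \<in> N" "norm (p x) < \<delta>"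
      if "x \<in> U" for x
    proof -
      have x: "x \<in> \<Omega>b" "x \<in> \<Omega>" "dist x xb < d"
        using that \<Omega>b by (auto simp: U_def dist_commute)
      then have "x \<noteq> xb" using xb(1) by metis
      with x near show "x \<in> \<Omega>b" "x \<in> \<Omega>" "u x \<in> Z" "v x \<in> Z" "grad u x \<in> N" "grad v x \<in> N"
        "norm (p x) < \<delta>" by blast+
    qed
    have pos: "0 < w x" if "x \<in> U" for x
      using Uin(1)[OF that] assms(19) by (simp add: w_def)
    define P where "P = (\<lambda>x. A x (v x) (grad v x) - A x (u x) (grad u x))"
    define K where "K = Ka + Kz + 1"
    define L where "L = b\<eta> * CARD('n)"
    have ellipticity: "P x \<bullet> p x \<ge> (norm (p x))\<^sup>2 / 2 - K * w x * norm (p x)"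
      "norm (P x) \<le> K * (norm (p x) + w x)" if x: "x \<in> U" for x
    proof -
      have "norm (P x - deriv_eta A x (u x) (grad u x) *v p x) \<le> Kz * \<bar>v x - u x\<bar> + 1 / 2 * norm (p x)"
        unfolding P_def p_def
      proof (rule flux_difference_linearization[OF assms(9), where N = N and Z = Z])
        fix \<eta> assume \<eta>: "\<eta> \<in> closed_segment (grad u x) (grad v x)"
        then have "\<eta> \<in> N"
          using closed_segment_subset[of "grad u x" N "grad v x"] Uin[OF x] by (auto simp: N)
        moreover have "dist \<eta> (grad u x) < \<delta>"
          using segment_bound(1)[OF \<eta>] Uin(7)[OF x] by (simp add: dist_norm p_def)
        then have "dist (x, u x, \<eta>) (x, u x, grad u x) < \<delta>" by (simp add: dist_Pair_Pair)
        ultimately have "dist (deriv_eta A x (u x) \<eta>) (deriv_eta A x (u x) (grad u x)) < 1 / 2"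
          using uc[rule_format, of "(x, u x, grad u x)" "(x, u x, \<eta>)"] Uin[OF x] by simp
        then show "norm (deriv_eta A x (u x) \<eta> - deriv_eta A x (u x) (grad u x)) \<le> 1 / 2"
          by (simp add: dist_norm)
      qed (use Uin[OF x] Kz_bound in \<open>auto simp: N Z_def\<close>)
      then have lin: "norm (P x - deriv_eta A x (u x) (grad u x) *v p x) \<le> Kz * w x + 1 / 2 * norm (p x)"
        using pos[OF x] by (simp add: w_def)
      have ell: "(norm (p x))\<^sup>2 \<le>
          (\<Sum>i\<in>UNIV. \<Sum>j\<in>UNIV. deriv_eta A x (u x) (grad u x) $ i $ j * p x $ i * p x $ j)"
        using assms(18) Uin(1)[OF x] unfolding elliptic_in_def by blast
      have "norm (deriv_eta A x (u x) (grad u x)) \<le> Ka" using Ka_bound Uin[OF x] by blast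
      from elliptic_perturbation[OF ell this less_imp_le[OF pos[OF x]] less_imp_le[OF Kz(1)] lin]
      show "P x \<bullet> p x \<ge> (norm (p x))\<^sup>2 / 2 - K * w x * norm (p x)"
        "norm (P x) \<le> K * (norm (p x) + w x)" by (simp_all add: K_def)
    qed
    have lower: "B x (v x) (grad v x) - B x (u x) (grad u x) \<ge> - bz * w x - L * norm (p x)"
      if x: "x \<in> U" for x
    proof -
      have "B x (v x) (grad v x) - B x (u x) (grad u x)
          \<ge> - bz * (v x - u x) - b\<eta> * (\<Sum>l\<in>UNIV. \<bar>grad v x $ l - grad u x $ l\<bar>)"
        using H(17) Uin[OF x] pos[OF x] by (simp add: w_def)
      moreover have "(\<Sum>l\<in>UNIV. \<bar>grad v x $ l - grad u x $ l\<bar>) \<le> CARD('n) * norm (p x)"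
        using sum_bounded_above[of UNIV "\<lambda>l. \<bar>p x $ l\<bar>" "norm (p x)"] component_le_norm_cart[of "p x"]
        by (simp add: p_def)
      then have "b\<eta> * (\<Sum>l\<in>UNIV. \<bar>grad v x $ l - grad u x $ l\<bar>) \<le> b\<eta> * (CARD('n) * norm (p x))"
        using assms(16) by (rule mult_left_mono)
      ultimately show ?thesis by (simp add: w_def L_def)
    qed

    obtain R a b where R: "0 < R" "R \<le> \<rho>" "cball e R \<subseteq> cbox a b" "box a b \<noteq> {}"
      and Q: "\<And>y. y \<in> cbox a b \<Longrightarrow> norm (y - e) \<le> \<rho>"
      using cube_around[OF \<rho>(1), of e] by blast
    \<comment> \<open>Points of the box have norm at most 2, hence d / 2.\<close>
    define s1 where "s1 = min (min s0 1) (d / 2)"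
    have s1: "0 < s1" "s1 \<le> s0" "s1 \<le> 1" "s1 \<le> d / 2" using s0 d by (auto simp: s1_def)
    have sub: "xb + s *\<^sub>R y \<in> U" if "0 < s" "s < s1" "y \<in> cbox a b" for s y
    proof -
      have "xb + s *\<^sub>R y \<in> \<Omega>b" using cone Q that s1 by auto
      moreover have "s * norm y \<le> s * 2" using norm_y Q that by (intro mult_left_mono) auto
      then have "s * norm y < d" using that(2) s1(4) by linarith
      ultimately show ?thesis using that by (simp add: U_def dist_norm)
    qed
    define E where "E = 4 * ((2 * K\<^sup>2 + K) * 16 + (2 * (K + L)\<^sup>2 + K + bz)) * R\<^sup>2 * measure lborel (cbox a b)"
    have energy: "integral (cbox a b)
        (\<lambda>y. bump e R y * (s * (norm (p (xb + s *\<^sub>R y)) / w (xb + s *\<^sub>R y)))\<^sup>2) \<le> E"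
      if s: "0 < s" "s < s1" for s
      unfolding E_def w_def p_def
    proof (rule rescaled_log_energy[OF assms(4-7) U])
      show "0 \<le> K" "0 \<le> L" using Ka Kz assms(16) by (auto simp: K_def L_def)
    qed (use pos ellipticity lower R \<rho> s s1 sub assms(15) in \<open>auto simp: w_def p_def P_def\<close>)
    have cp: "continuous_on U p"
      unfolding p_def using C1_closure_onD(2) assms(4,5) U(2) continuous_on_subset
      by (intro continuous_on_diff) blast+
    have cw: "continuous_on U w"
      using dw U by (meson continuous_on_eq_continuous_at has_derivative_continuous subsetD)
    have dwU: "(w has_derivative (\<lambda>h. p x \<bullet> h)) (at x)" if "x \<in> U" for x
      using dw U that by blast
    have normQ: "norm y \<le> 2" if "y \<in> cbox a b" for y
      using norm_y Q that by blast
    have "\<exists>c M. \<forall>s. 0 < s \<longrightarrow> s < s1 / 2 \<longrightarrow>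
        c + M * ln s \<le> integral (cbox a b) (\<lambda>y. bump e R y * ln (w (xb + s *\<^sub>R y)))"
      by (rule log_mean_lower_bound[OF s1(1) U(1) sub pos dwU cp continuous_on_bump bump_nonneg
            normQ zero_le_numeral energy])
    then obtain c M where mean: "\<And>s. 0 < s \<Longrightarrow> s < s1 / 2 \<Longrightarrow>
        c + M * ln s \<le> integral (cbox a b) (\<lambda>y. bump e R y * ln (w (xb + s *\<^sub>R y)))"
      by blast
    show False
    proof (rule log_mean_bound_excludes_powers[where ?s0.0 = "s1 / 2" and w = w and ?x0.0 = xb
            and \<phi> = "bump e R" and a = a and b = b])
      show "continuous_on (cbox a b) (\<lambda>y. w (xb + s *\<^sub>R y))" if "0 < s" "s < s1 / 2" for s
        using that s1(1) by (intro continuous_on_compose2[OF cw] continuous_intros) (auto intro!: sub)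
      show "0 < integral (cbox a b) (bump e R)" using integral_bump_pos R by blast
      show "\<exists>C s1. 0 < s1 \<and> (\<forall>s y. 0 < s \<longrightarrow> s < s1 \<longrightarrow> y \<in> cbox a b \<longrightarrow> w (xb + s *\<^sub>R y) \<le> C * s ^ m)" for m
      proof -
        obtain C s1 where "0 < s1" and C: "\<And>s y. 0 < s \<Longrightarrow> s < s1 \<Longrightarrow> norm (y - e) \<le> \<rho> \<Longrightarrow>
            \<bar>w (xb + s *\<^sub>R y)\<bar> \<le> C * s ^ m"
          using power_bound[of m] by blast
        then show ?thesis using abs_le_D1[OF C] Q by blast
      qed
    qed (use s1 sub pos mean in \<open>auto simp: bump_nonneg continuous_on_bump\<close>)
  qed
  then show ?thesis
    using assms(20) by (simp add: finite_order_zero_def w_def)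
qed

end
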